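(* Let $X$ be a compact convex subset of a real Hausdorff locally convex space, let $\operatorname{ext} X$ be the set of extreme points of $X$, and let $f\colon X\to\mathbb{R}$ be an affine function with the point of continuity property. If $f\le 0$ on $\operatorname{ext} X$, then $f\le 0$ on $X$.
   Context: All vector spaces are real. A function $f$ on a compact convex set $X$ is affine if $f(\lambda x+(1-\lambda)y)=\lambda f(x)+(1-\lambda)f(y)$ for all $x,y\in X$ and $\lambda\in[0,1]$; no continuity or boundedness is assumed. A function $f\colon X\to\mathbb{R}$ has the point of continuity property if for every nonempty closed set $F\subseteq X$ the restriction $f|_F\colon F\to\mathbb{R}$ (with $F$ carrying the relative topology) has at least one point of continuity. *)

theory Defs
  imports "HOL-Analysis.Analysis"
begin

class real_topological_vector = real_vector + topological_ab_group_add +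
  assumes tendsto_scaleR_Pair:
    "((\<lambda>p. fst p *\<^sub>R snd p) \<longlongrightarrow> r *\<^sub>R x) (nhds r \<times>\<^sub>F nhds x)"

text \<open>Hausdorffness is not part of this class; combine it with \<^class>\<open>t2_space\<close> where needed.\<close>

text \<open>The constant \<^const>\<open>convex\<close> cannot occur in a class specification, so its definition is
  written out; see \<open>ex_convex_open_nhds_0\<close>.\<close>

class locally_convex_space = real_topological_vector +
  assumes convex_nhds_0:
    "open U \<Longrightarrow> 0 \<in> U \<Longrightarrow>
       \<exists>V. open V \<and> 0 \<in> V \<and> V \<subseteq> U \<and>
           (\<forall>x\<in>V. \<forall>y\<in>V. \<forall>u\<ge>0. \<forall>v\<ge>0. u + v = 1 \<longrightarrow> u *\<^sub>R x + v *\<^sub>R y \<in> V)"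

lemma ex_convex_open_nhds_0:
  fixes U :: "'a::locally_convex_space set"
  shows "open U \<Longrightarrow> 0 \<in> U \<Longrightarrow> \<exists>V. open V \<and> 0 \<in> V \<and> V \<subseteq> U \<and> convex V"
  using convex_nhds_0[of U] unfolding convex_def .

instance real_normed_vector < locally_convex_space
proof
  fix r :: real and x :: 'a
  have "((\<lambda>p. fst p) \<longlongrightarrow> r) (nhds r \<times>\<^sub>F nhds x)" "((\<lambda>p. snd p) \<longlongrightarrow> x) (nhds r \<times>\<^sub>F nhds x)"
    by (rule filterlim_fst filterlim_snd)+
  then show "((\<lambda>p. fst p *\<^sub>R snd p) \<longlongrightarrow> r *\<^sub>R x) (nhds r \<times>\<^sub>F nhds x)"
    by (rule tendsto_scaleR)
next
  fix U :: "'a set"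
  assume "open U" "0 \<in> U"
  then obtain e where "e > 0" "ball 0 e \<subseteq> U"
    by (meson open_contains_ball)
  then show "\<exists>V. open V \<and> 0 \<in> V \<and> V \<subseteq> U \<and>
      (\<forall>x\<in>V. \<forall>y\<in>V. \<forall>u\<ge>0. \<forall>v\<ge>0. u + v = 1 \<longrightarrow> u *\<^sub>R x + v *\<^sub>R y \<in> V)"
    using convex_ball[of 0 e] unfolding convex_def
    by (intro exI[of _ "ball 0 e"]) simp
qed

text \<open>In the next two definitions \<open>f\<close> represents a function on \<open>X\<close>; its values outside \<open>X\<close>
  play no role when \<open>X\<close> is convex.\<close>

definition affine_fun_on :: "'a::real_vector set \<Rightarrow> ('a \<Rightarrow> real) \<Rightarrow> bool" where
  "affine_fun_on X f \<longleftrightarrow>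
     (\<forall>x\<in>X. \<forall>y\<in>X. \<forall>t\<in>{0..1}. f (t *\<^sub>R x + (1 - t) *\<^sub>R y) = t * f x + (1 - t) * f y)"

text \<open>Since \<open>at x within F\<close> is the punctured filter, a relatively isolated point of \<open>F\<close> counts as
  a point of continuity, as it should.\<close>

definition point_of_continuity_property :: "'a::t2_space set \<Rightarrow> ('a \<Rightarrow> real) \<Rightarrow> bool" where
  "point_of_continuity_property X f \<longleftrightarrow>
     (\<forall>F. closedin (top_of_set X) F \<and> F \<noteq> {} \<longrightarrow> (\<exists>x\<in>F. continuous (at x within F) f))"

end

theory Submission
  imports Defs
begin

text \<open>Suppose \<open>f x > 0\<close> for some \<open>x \<in> X\<close>. It suffices to find a nonempty compact set
  \<open>G \<subseteq> {x \<in> X. f x > 0}\<close> that contains two points of \<open>X\<close> as soon as it contains their midpoint: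
  the proof of the Krein--Milman theorem then yields an extreme point of \<open>X\<close> in \<open>G\<close>, contrary to the
  hypothesis. If \<open>f\<close> were upper semicontinuous, the set where it attains its maximum would do. In
  general \<open>f\<close> need not attain its supremum, and as in Stegall's variational principle it is perturbed
  by continuous affine functions: there are \<open>g\<^sub>0 = f\<close>, \<open>g\<^sub>1\<close>, \<open>g\<^sub>2\<close>, ..., each one the sum of its
  predecessor and a continuous affine function, whose superlevel sets \<open>A\<^sub>n = {g\<^sub>n > c\<^sub>n}\<close> are nonempty
  with \<open>closure A\<^bsub>n+1\<^esub> \<subseteq> A\<^sub>n\<close>, and whose levels are so close to the suprema that both endpoints of a
  segment lie in \<open>A\<^sub>n\<close> if its midpoint is in \<open>A\<^bsub>n+1\<^esub>\<close>. Then \<open>G = (\<Inter>n. closure A\<^sub>n)\<close>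
  (\<open>exists_compact_extremal_superlevel_subset\<close>).

  One perturbation (\<open>superlevel_perturbation\<close>) comes from a slice, that is, from the part of a compact
  convex set in an open half space. Take \<open>\<Gamma> \<subseteq> X \<times> \<real>\<close>, the closed convex hull of the floor
  \<open>X \<times> {d}\<close> and of the graph of \<open>f\<close> over \<open>{f > d}\<close>, and \<open>F (x, t) = t - f x\<close>, which is \<open>0\<close> on the
  graph. A slice of \<open>\<Gamma>\<close> that misses the floor is given by a functional \<open>t + h x\<close>; if \<open>F\<close> oscillates
  little on it, then \<open>f x\<close> is close to \<open>t\<close>, hence not much less than \<open>d\<close>, at each of its points
  \<open>(x, t)\<close>, and every point in the closure of a suitable superlevel set of \<open>f + h\<close> lies below such a
  point.

  Such slices exist by a version of the Namioka--Bourgain superlemma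
  (\<open>exists_slice_of_small_oscillation\<close>). Take a minimal closed set \<open>L\<close> that, together with the floor,
  generates \<open>\<Gamma>\<close>. Around a point of continuity of \<open>F\<close> restricted to \<open>L\<close>, the function oscillates
  little on a relatively open piece of \<open>L\<close>; by minimality the rest of \<open>L\<close> and the floor generate less
  than \<open>\<Gamma>\<close>, so that suitable slices consist of points which are almost in the closed convex hull of
  the piece.

  Hence a bound for an affine \<open>f\<close> with the point of continuity property must pass from a closed set \<open>K\<close>
  to its closed convex hull, although \<open>f\<close> is not semicontinuous (\<open>affine_le_on_cconv\<close>). Classically
  this follows by integrating \<open>f\<close> against a measure on \<open>K\<close>; here it is a convexity argument. If \<open>L\<close> is
  a minimal closed subset of \<open>K\<close> with \<open>x\<close> in its closed convex hull, then the face generated by \<open>x\<close> is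
  dense in that hull (\<open>generated_face_dense\<close>), and so are the convex combinations of \<open>L\<close>, where
  \<open>f \<le> c\<close>. Near a point of continuity this gives \<open>x = t y + (1 - t) z\<close> with \<open>t > 0\<close> and \<open>f y\<close> at most
  slightly larger than \<open>c\<close>. Splitting off such parts again and again exhausts \<open>x\<close>
  (\<open>affine_le_by_exhaustion\<close>).\<close>

section \<open>Topological vector spaces and their products\<close>

lemma tendsto_scaleR_tvs:
  fixes g :: "'b \<Rightarrow> 'a::real_topological_vector"
  assumes "(f \<longlongrightarrow> r) F" "(g \<longlongrightarrow> x) F"
  shows "((\<lambda>z. f z *\<^sub>R g z) \<longlongrightarrow> r *\<^sub>R x) F"
  using filterlim_compose[OF tendsto_scaleR_Pair, of "\<lambda>z. (f z, g z)" r x F] assms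
  by (simp add: nhds_prod[symmetric] tendsto_Pair)

lemma continuous_on_scaleR_tvs [continuous_intros]:
  fixes g :: "'b::topological_space \<Rightarrow> 'a::real_topological_vector"
  shows "continuous_on S f \<Longrightarrow> continuous_on S g \<Longrightarrow> continuous_on S (\<lambda>z. f z *\<^sub>R g z)"
  unfolding continuous_on_def by (auto intro: tendsto_scaleR_tvs)

text \<open>The graph of \<open>f\<close> lives in \<open>X \<times> \<real>\<close>, so products of locally convex spaces must be locally
  convex. The arity is declared one class at a time, starting with additive monoids: the sort algebra
  has to remain coregular with the existing arity of \<^typ>\<open>'a \<times> 'b\<close> for normed spaces.\<close>

instance prod :: (topological_monoid_add, topological_monoid_add) topological_monoid_add
proof
  fix a b :: "'a \<times> 'b"
  have 1: "((\<lambda>p. fst p) \<longlongrightarrow> a) (nhds a \<times>\<^sub>F nhds b)"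
    and 2: "((\<lambda>p. snd p) \<longlongrightarrow> b) (nhds a \<times>\<^sub>F nhds b)"
    by (rule filterlim_fst filterlim_snd)+
  show "((\<lambda>p. fst p + snd p) \<longlongrightarrow> a + b) (nhds a \<times>\<^sub>F nhds b)"
    using tendsto_Pair[OF tendsto_add[OF tendsto_fst[OF 1] tendsto_fst[OF 2]]
        tendsto_add[OF tendsto_snd[OF 1] tendsto_snd[OF 2]]]
    by (simp add: plus_prod_def)
qed

instance prod :: (topological_comm_monoid_add, topological_comm_monoid_add)
  topological_comm_monoid_add ..

instance prod :: (topological_group_add, topological_group_add) topological_group_add
proof
  fix a :: "'a \<times> 'b"
  have 3: "((\<lambda>p. p) \<longlongrightarrow> a) (nhds a)"
    by (rule filterlim_ident)
  show "(uminus \<longlongrightarrow> - a) (nhds a)"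
    using tendsto_Pair[OF tendsto_minus[OF tendsto_fst[OF 3]] tendsto_minus[OF tendsto_snd[OF 3]]]
    by (simp add: uminus_prod_def[abs_def])
qed

instance prod :: (topological_ab_group_add, topological_ab_group_add) topological_ab_group_add ..

instance prod :: (real_topological_vector, real_topological_vector) real_topological_vector
proof
  fix r :: real and x :: "'a \<times> 'b"
  have 1: "((\<lambda>p. fst p) \<longlongrightarrow> r) (nhds r \<times>\<^sub>F nhds x)"
    and 2: "((\<lambda>p. snd p) \<longlongrightarrow> x) (nhds r \<times>\<^sub>F nhds x)"
    by (rule filterlim_fst filterlim_snd)+
  show "((\<lambda>p. fst p *\<^sub>R snd p) \<longlongrightarrow> r *\<^sub>R x) (nhds r \<times>\<^sub>F nhds x)"
    using tendsto_Pair[OF tendsto_scaleR_tvs[OF 1 tendsto_fst[OF 2]]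
        tendsto_scaleR_tvs[OF 1 tendsto_snd[OF 2]]]
    by (simp add: scaleR_prod_def)
qed

instance prod :: (locally_convex_space, locally_convex_space) locally_convex_space
proof
  fix U :: "('a \<times> 'b) set"
  assume "open U" "0 \<in> U"
  from open_prod_elim[OF this] obtain A B where
    AB: "open A" "open B" "0 \<in> A \<times> B" "A \<times> B \<subseteq> U"
    by blast
  then have "0 \<in> A" "0 \<in> B" by (auto simp: zero_prod_def)
  obtain A' where A': "open A'" "0 \<in> A'" "A' \<subseteq> A" "convex A'"
    using ex_convex_open_nhds_0[OF AB(1) \<open>0 \<in> A\<close>] by blast
  obtain B' where B': "open B'" "0 \<in> B'" "B' \<subseteq> B" "convex B'"
    using ex_convex_open_nhds_0[OF AB(2) \<open>0 \<in> B\<close>] by blast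
  have "convex (A' \<times> B')"
    using A'(4) B'(4) by (rule convex_Times)
  moreover have "open (A' \<times> B')" "0 \<in> A' \<times> B'" "A' \<times> B' \<subseteq> U"
    using A' B' AB by (auto intro: open_Times simp: zero_prod_def)
  ultimately show "\<exists>V. open V \<and> 0 \<in> V \<and> V \<subseteq> U \<and>
      (\<forall>x\<in>V. \<forall>y\<in>V. \<forall>u\<ge>0. \<forall>v\<ge>0. u + v = 1 \<longrightarrow> u *\<^sub>R x + v *\<^sub>R y \<in> V)"
    unfolding convex_def by (intro exI[of _ "A' \<times> B'"]) simp
qed

lemma convex_closure_tvs:
  fixes S :: "'a::real_topological_vector set"
  assumes "convex S"
  shows "convex (closure S)"
proof (rule convexI)
  fix x y :: 'a and u v :: real
  assume *: "x \<in> closure S" "y \<in> closure S" "0 \<le> u" "0 \<le> v" "u + v = 1"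
  have "(\<lambda>p. u *\<^sub>R fst p + v *\<^sub>R snd p) ` closure (S \<times> S) \<subseteq> closure S"
  proof (rule image_closure_subset)
    show "(\<lambda>p. u *\<^sub>R fst p + v *\<^sub>R snd p) ` (S \<times> S) \<subseteq> closure S"
      using convexD[OF assms _ _ *(3,4,5)] closure_subset[of S] by auto
  qed (auto intro!: continuous_intros)
  then show "u *\<^sub>R x + v *\<^sub>R y \<in> closure S"
    using * by (force simp: closure_Times image_subset_iff)
qed

section \<open>The Hahn--Banach theorem\<close>

definition sublinear :: "('a::real_vector \<Rightarrow> real) \<Rightarrow> bool" where
  "sublinear p \<longleftrightarrow> (\<forall>x y. p (x + y) \<le> p x + p y) \<and> (\<forall>r x. r > 0 \<longrightarrow> p (r *\<^sub>R x) = r * p x)"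

lemma sublinear_add: "sublinear p \<Longrightarrow> p (x + y) \<le> p x + p y"
  and sublinear_scale: "sublinear p \<Longrightarrow> r > 0 \<Longrightarrow> p (r *\<^sub>R x) = r * p x"
  unfolding sublinear_def by auto

lemma sublinear_0: "sublinear p \<Longrightarrow> p 0 = 0"
  using sublinear_scale[of p 2 0] by simp

lemma sublinear_scale_nonneg: "sublinear p \<Longrightarrow> r \<ge> 0 \<Longrightarrow> p (r *\<^sub>R x) = r * p x"
  using sublinear_scale[of p r x] sublinear_0[of p] by (cases "r = 0") auto

lemma sublinear_minus: "sublinear p \<Longrightarrow> - p (- x) \<le> p x"
  using sublinear_add[of p x "-x"] sublinear_0[of p] by simp

text \<open>Tilting \<open>p\<close> along the ray of \<open>y\<close>, i.e. passing to
  \<open>q x = (INF t\<in>{0..}. p (x + t y) - t p y)\<close>, keeps it sublinear and makes it odd on the line of \<open>y\<close>.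
  Applied to a minimal sublinear functional, which the tilt cannot change, this yields linearity.\<close>

lemma sublinear_tilt:
  fixes p :: "'a::real_vector \<Rightarrow> real"
  assumes p: "sublinear p"
  shows "\<exists>q. sublinear q \<and> (\<forall>x. q x \<le> p x) \<and> q (- y) \<le> - p y"
proof -
  let ?A = "\<lambda>x. (\<lambda>t. p (x + t *\<^sub>R y) - t * p y) ` {0..}"
  define q where "q x = Inf (?A x)" for x
  have lb: "- p (- x) \<le> p (x + t *\<^sub>R y) - t * p y" if "t \<ge> 0" for x t
    using sublinear_add[OF p, of "x + t *\<^sub>R y" "-x"] sublinear_scale_nonneg[OF p that, of y] by simp
  have bdd: "bdd_below (?A x)" for x
    using lb by (intro bdd_belowI2[where m = "- p (- x)"]) auto
  have le: "q x \<le> p (x + t *\<^sub>R y) - t * p y" if "t \<ge> 0" for x t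
    unfolding q_def by (rule cINF_lower[OF bdd]) (use that in auto)
  have ge: "m \<le> q x" if "\<And>t. t \<ge> 0 \<Longrightarrow> m \<le> p (x + t *\<^sub>R y) - t * p y" for x m
    unfolding q_def by (rule cINF_greatest) (use that in auto)
  have add: "q (a + b) \<le> q a + q b" for a b
  proof -
    have "q (a + b) - (p (b + t *\<^sub>R y) - t * p y) \<le> q a" if "t \<ge> 0" for t
    proof (rule ge)
      fix s :: real assume "s \<ge> 0"
      have "q (a + b) \<le> p (a + b + (s + t) *\<^sub>R y) - (s + t) * p y"
        using le[of "s + t"] \<open>s \<ge> 0\<close> \<open>t \<ge> 0\<close> by simp
      also have "p (a + b + (s + t) *\<^sub>R y) \<le> p (a + s *\<^sub>R y) + p (b + t *\<^sub>R y)"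
        using sublinear_add[OF p, of "a + s *\<^sub>R y" "b + t *\<^sub>R y"] by (simp add: algebra_simps)
      finally show "q (a + b) - (p (b + t *\<^sub>R y) - t * p y) \<le> p (a + s *\<^sub>R y) - s * p y"
        by (simp add: algebra_simps)
    qed
    then have "q (a + b) - q a \<le> q b"
      by (intro ge) (simp add: algebra_simps)
    then show ?thesis by simp
  qed
  have le_scale: "q (r *\<^sub>R x) \<le> r * q x" if "r > 0" for r x
  proof -
    have "q (r *\<^sub>R x) / r \<le> q x"
    proof (rule ge)
      fix t :: real assume "t \<ge> 0"
      have "q (r *\<^sub>R x) \<le> p (r *\<^sub>R x + (r * t) *\<^sub>R y) - (r * t) * p y"
        using le[of "r * t"] that \<open>t \<ge> 0\<close> by simp
      also have "r *\<^sub>R x + (r * t) *\<^sub>R y = r *\<^sub>R (x + t *\<^sub>R y)"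
        by (simp add: algebra_simps)
      also have "p (r *\<^sub>R (x + t *\<^sub>R y)) = r * p (x + t *\<^sub>R y)"
        by (rule sublinear_scale[OF p that])
      finally show "q (r *\<^sub>R x) / r \<le> p (x + t *\<^sub>R y) - t * p y"
        using that by (simp add: field_simps)
    qed
    then show ?thesis using that by (simp add: field_simps)
  qed
  have "q (r *\<^sub>R x) = r * q x" if "r > 0" for r x
    using le_scale[OF that, of x] le_scale[of "1 / r" "r *\<^sub>R x"] that by (simp add: field_simps)
  with add have "sublinear q" unfolding sublinear_def by blast
  moreover have "q x \<le> p x" for x using le[of 0 x] by simp
  moreover have "q (- y) \<le> - p y" using le[of 1 "- y"] sublinear_0[OF p] by simp
  ultimately show ?thesis by blast
qed

text \<open>The pointwise infimum of a chain is again sublinear; it is finite since each \<open>f\<close> below \<open>p\<close>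
  satisfies \<open>f x \<ge> - f (- x) \<ge> - p (- x)\<close>.\<close>

lemma exists_minimal_sublinear:
  fixes p :: "'a::real_vector \<Rightarrow> real"
  assumes p: "sublinear p"
  shows "\<exists>m. sublinear m \<and> (\<forall>x. m x \<le> p x) \<and>
    (\<forall>q. sublinear q \<and> (\<forall>x. q x \<le> m x) \<longrightarrow> q = m)"
proof -
  let ?A = "{q. sublinear q \<and> (\<forall>x. q x \<le> p x)}"
  let ?P = "\<lambda>f g :: 'a \<Rightarrow> real. \<forall>x. g x \<le> f x"
  have "\<exists>m\<in>?A. \<forall>q\<in>?A. ?P m q \<longrightarrow> q = m"
  proof (rule predicate_Zorn)
    show "partial_order_on ?A (relation_of ?P ?A)"
    proof (rule partial_order_on_relation_ofI)
      show "?P a c" if "?P a b" "?P b c" for a b c :: "'a \<Rightarrow> real"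
        using that by (meson order.trans)
      show "a = b" if "?P a b" "?P b a" for a b :: "'a \<Rightarrow> real"
        using that by (intro ext antisym) auto
    qed simp
  next
    fix C assume "C \<in> Chains (relation_of ?P ?A)"
    then have CA: "C \<subseteq> ?A" and ch: "\<And>f g. f \<in> C \<Longrightarrow> g \<in> C \<Longrightarrow> ?P f g \<or> ?P g f"
      unfolding Chains_def relation_of_def by auto
    show "\<exists>u\<in>?A. \<forall>a\<in>C. ?P a u"
    proof (cases "C = {}")
      case True
      then show ?thesis using p by auto
    next
      case False
      define u where "u x = Inf ((\<lambda>f. f x) ` C)" for x
      have lb: "- p (- x) \<le> f x" if "f \<in> C" for f x
      proof -
        have "sublinear f" "f (- x) \<le> p (- x)" using CA that by auto
        then show ?thesis using sublinear_minus[of f x] by linarith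
      qed
      have bdd: "bdd_below ((\<lambda>f. f x) ` C)" for x
        using lb by (intro bdd_belowI2[where m = "- p (- x)"]) auto
      have le: "u x \<le> f x" if "f \<in> C" for f x
        unfolding u_def by (rule cINF_lower[OF bdd that])
      have ge: "m \<le> u x" if "\<And>f. f \<in> C \<Longrightarrow> m \<le> f x" for m x
        unfolding u_def by (rule cINF_greatest[OF False that])
      have "u (a + b) \<le> u a + u b" for a b
      proof -
        have "u (a + b) - f b \<le> u a" if f: "f \<in> C" for f
        proof (rule ge)
          fix g assume g: "g \<in> C"
          obtain h where h: "h \<in> C" "h a \<le> g a" "h b \<le> f b"
            using ch[OF f g] f g by blast
          have "u (a + b) \<le> h (a + b)" by (rule le[OF h(1)])
          also have "\<dots> \<le> h a + h b"
            using h(1) CA by (auto intro: sublinear_add)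
          finally show "u (a + b) - f b \<le> g a" using h by linarith
        qed
        then have "u (a + b) - u a \<le> u b"
          by (intro ge) (simp add: algebra_simps)
        then show ?thesis by simp
      qed
      moreover have le_scale: "u (r *\<^sub>R x) \<le> r * u x" if "r > 0" for r x
      proof -
        have "u (r *\<^sub>R x) / r \<le> u x"
        proof (rule ge)
          fix f assume f: "f \<in> C"
          then have "f (r *\<^sub>R x) = r * f x" using CA sublinear_scale[of f r x] that by auto
          then show "u (r *\<^sub>R x) / r \<le> f x"
            using le[OF f, of "r *\<^sub>R x"] that by (simp add: field_simps)
        qed
        then show ?thesis using that by (simp add: field_simps)
      qed
      have "u (r *\<^sub>R x) = r * u x" if "r > 0" for r x
        using le_scale[OF that, of x] le_scale[of "1 / r" "r *\<^sub>R x"] that by (simp add: field_simps)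
      ultimately have "sublinear u" unfolding sublinear_def by blast
      moreover have "u x \<le> p x" for x
      proof -
        obtain f where "f \<in> C" using False by blast
        then have "u x \<le> f x" "f x \<le> p x" using le CA by auto
        then show ?thesis by linarith
      qed
      ultimately show ?thesis using le by blast
    qed
  qed
  then obtain m where m: "sublinear m" "\<forall>x. m x \<le> p x"
      "\<And>q. q \<in> ?A \<Longrightarrow> ?P m q \<Longrightarrow> q = m" by blast
  have "q = m" if q: "sublinear q" "\<forall>x. q x \<le> m x" for q
  proof (rule m(3))
    have "q x \<le> p x" for x using q(2) m(2) by (meson order.trans)
    then show "q \<in> ?A" using q(1) by simp
  qed (rule q(2))
  with m show ?thesis by blast
qed

text \<open>A minimal sublinear functional is linear, so one below \<open>p\<close> would do but for its value at \<open>x0\<close>;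
  tilting \<open>p\<close> along \<open>x0\<close> beforehand forces that value.\<close>

lemma Hahn_Banach_sublinear:
  fixes p :: "'a::real_vector \<Rightarrow> real"
  assumes p: "sublinear p"
  shows "\<exists>l. linear l \<and> (\<forall>x. l x \<le> p x) \<and> l x0 = p x0"
proof -
  obtain p' where p': "sublinear p'" "\<forall>x. p' x \<le> p x" "p' (- x0) \<le> - p x0"
    using sublinear_tilt[OF p, of x0] by blast
  obtain m where m: "sublinear m" "\<forall>x. m x \<le> p' x"
    and min: "\<And>q. sublinear q \<Longrightarrow> \<forall>x. q x \<le> m x \<Longrightarrow> q = m"
    using exists_minimal_sublinear[OF p'(1)] by blast
  have odd: "m (- y) = - m y" for y
  proof -
    obtain q where q: "sublinear q" "\<forall>x. q x \<le> m x" "q (- y) \<le> - m y"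
      using sublinear_tilt[OF m(1), of y] by blast
    have "q = m" by (rule min[OF q(1,2)])
    then show ?thesis using q(3) sublinear_minus[OF m(1), of "- y"] by simp
  qed
  have add: "m (x + y) = m x + m y" for x y
    using sublinear_add[OF m(1), of x y] sublinear_add[OF m(1), of "x + y" "- y"] odd[of y] by simp
  have scale: "m (r *\<^sub>R x) = r * m x" for r x
  proof (cases "r \<ge> 0")
    case True
    then show ?thesis by (rule sublinear_scale_nonneg[OF m(1)])
  next
    case False
    then show ?thesis
      using sublinear_scale_nonneg[OF m(1), of "- r" x] odd[of "r *\<^sub>R x"] by simp
  qed
  have "linear m" by (rule linearI) (auto simp: add scale)
  moreover have "m x \<le> p x" for x using m(2) p'(2) by (meson order.trans)
  moreover have "m x0 = p x0"
  proof -
    have "m (- x0) \<le> p' (- x0)" using m(2) by blast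
    then show ?thesis using p'(3) odd[of x0] \<open>\<And>x. m x \<le> p x\<close>[of x0] by linarith
  qed
  ultimately show ?thesis by blast
qed

section \<open>Separation of points from closed convex sets\<close>

abbreviation continuous_functional :: "('a::real_topological_vector \<Rightarrow> real) \<Rightarrow> bool" where
  "continuous_functional l \<equiv> linear l \<and> continuous_on UNIV l"

lemma absorbing_nhds_0:
  fixes A :: "'a::real_topological_vector set"
  assumes "open A" "0 \<in> A"
  obtains s :: real where "s > 0" "s *\<^sub>R x \<in> A"
proof -
  have "((\<lambda>s::real. s *\<^sub>R x) \<longlongrightarrow> 0 *\<^sub>R x) (at_right 0)"
    by (intro tendsto_scaleR_tvs tendsto_const tendsto_ident_at)
  then have "\<forall>\<^sub>F s in at_right (0::real). s *\<^sub>R x \<in> A"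
    using assms by (auto dest!: topological_tendstoD)
  then have "\<forall>\<^sub>F s in at_right (0::real). s *\<^sub>R x \<in> A \<and> s > 0"
    using eventually_at_right_less[of "0::real"] by eventually_elim auto
  then show ?thesis
    using that eventually_happens'[of "at_right (0::real)"] by auto
qed

lemma linear_bounded_imp_continuous:
  fixes l :: "'a::real_topological_vector \<Rightarrow> real"
  assumes l: "linear l" and A: "open A" "0 \<in> A" "\<And>x. x \<in> A \<Longrightarrow> l x \<le> 1"
  shows "continuous_on UNIV l"
  unfolding continuous_on_def
proof (intro ballI)
  fix x :: 'a
  show "(l \<longlongrightarrow> l x) (at x within UNIV)"
  proof (rule tendstoI)
    fix e :: real assume e: "e > 0"
    have "((\<lambda>y. (2 / e) *\<^sub>R (y - x)) \<longlongrightarrow> (2 / e) *\<^sub>R (x - x)) (at x)"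
      by (intro tendsto_scaleR_tvs tendsto_intros)
    then have 1: "\<forall>\<^sub>F y in at x. (2 / e) *\<^sub>R (y - x) \<in> A"
      using A by (auto dest!: topological_tendstoD)
    have "((\<lambda>y. (2 / e) *\<^sub>R (x - y)) \<longlongrightarrow> (2 / e) *\<^sub>R (x - x)) (at x)"
      by (intro tendsto_scaleR_tvs tendsto_intros)
    then have 2: "\<forall>\<^sub>F y in at x. (2 / e) *\<^sub>R (x - y) \<in> A"
      using A by (auto dest!: topological_tendstoD)
    from 1 2 have "\<forall>\<^sub>F y in at x. dist (l y) (l x) < e"
    proof eventually_elim
      case (elim y)
      have "(2 / e) * (l y - l x) \<le> 1" "(2 / e) * (l x - l y) \<le> 1"
        using A(3)[OF elim(1)] A(3)[OF elim(2)] by (simp_all add: linear_scale[OF l] linear_diff[OF l])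
      then have "\<bar>l y - l x\<bar> \<le> e / 2" using e by (simp add: field_simps abs_if)
      then show ?case using e by (simp add: dist_real_def)
    qed
    then show "\<forall>\<^sub>F y in at x within UNIV. dist (l y) (l x) < e" by simp
  qed
qed

definition minkowski_functional :: "'a::real_vector set \<Rightarrow> 'a \<Rightarrow> real" where
  "minkowski_functional A x = Inf {s. s > 0 \<and> (1 / s) *\<^sub>R x \<in> A}"

lemma minkowski_functional_properties:
  fixes A :: "'a::real_topological_vector set"
  assumes A: "open A" "0 \<in> A" "convex A"
  shows "sublinear (minkowski_functional A)"
    and "x \<in> A \<Longrightarrow> minkowski_functional A x \<le> 1"
    and "x \<notin> A \<Longrightarrow> 1 \<le> minkowski_functional A x"
proof -
  let ?S = "\<lambda>x. {s. s > 0 \<and> (1 / s) *\<^sub>R x \<in> A}"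
  have ne: "?S x \<noteq> {}" for x
  proof -
    obtain s :: real where "s > 0" "s *\<^sub>R x \<in> A" by (rule absorbing_nhds_0[OF A(1,2)])
    then have "1 / s \<in> ?S x" by simp
    then show ?thesis by blast
  qed
  have bdd: "bdd_below (?S x)" for x by (rule bdd_belowI[of _ 0]) auto
  have le: "minkowski_functional A x \<le> s" if "s > 0" "(1 / s) *\<^sub>R x \<in> A" for x s
    unfolding minkowski_functional_def by (rule cInf_lower[OF _ bdd]) (use that in auto)
  have ge: "m \<le> minkowski_functional A x" if "\<And>s. s > 0 \<Longrightarrow> (1 / s) *\<^sub>R x \<in> A \<Longrightarrow> m \<le> s" for x m
    unfolding minkowski_functional_def by (rule cInf_greatest[OF ne]) (use that in auto)
  have "minkowski_functional A (x + y) \<le> minkowski_functional A x + minkowski_functional A y" for x y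
  proof -
    have "minkowski_functional A (x + y) - t \<le> minkowski_functional A x" if t: "t > 0" "(1 / t) *\<^sub>R y \<in> A" for t
    proof (rule ge)
      fix s :: real assume s: "s > 0" "(1 / s) *\<^sub>R x \<in> A"
      have "(s / (s + t)) *\<^sub>R ((1 / s) *\<^sub>R x) + (t / (s + t)) *\<^sub>R ((1 / t) *\<^sub>R y) \<in> A"
        using s t by (intro convexD[OF A(3)]) (auto simp flip: add_divide_distrib)
      then have "(1 / (s + t)) *\<^sub>R (x + y) \<in> A"
        using s t by (simp add: scaleR_add_right)
      then show "minkowski_functional A (x + y) - t \<le> s"
        using le[of "s + t" "x + y"] s t by simp
    qed
    then have "minkowski_functional A (x + y) - minkowski_functional A x \<le> minkowski_functional A y"
      by (intro ge) (simp add: algebra_simps)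
    then show ?thesis by simp
  qed
  moreover have le_scale: "minkowski_functional A (r *\<^sub>R x) \<le> r * minkowski_functional A x" if "r > 0" for r x
  proof -
    have "minkowski_functional A (r *\<^sub>R x) / r \<le> minkowski_functional A x"
    proof (rule ge)
      fix s :: real assume "s > 0" "(1 / s) *\<^sub>R x \<in> A"
      then have "minkowski_functional A (r *\<^sub>R x) \<le> r * s" using that by (intro le) auto
      then show "minkowski_functional A (r *\<^sub>R x) / r \<le> s" using that by (simp add: field_simps)
    qed
    then show ?thesis using that by (simp add: field_simps)
  qed
  have "minkowski_functional A (r *\<^sub>R x) = r * minkowski_functional A x" if "r > 0" for r x
    using le_scale[OF that, of x] le_scale[of "1 / r" "r *\<^sub>R x"] that by (simp add: field_simps)
  ultimately show "sublinear (minkowski_functional A)" unfolding sublinear_def by blast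
  show "minkowski_functional A x \<le> 1" if "x \<in> A" using le[of 1 x] that by simp
  show "1 \<le> minkowski_functional A x" if "x \<notin> A"
  proof (rule ge)
    fix s :: real assume s: "s > 0" "(1 / s) *\<^sub>R x \<in> A"
    show "1 \<le> s"
    proof (rule ccontr)
      assume "\<not> 1 \<le> s"
      then have "s *\<^sub>R ((1 / s) *\<^sub>R x) + (1 - s) *\<^sub>R 0 \<in> A"
        using s by (intro convexD[OF A(3)] A(2)) auto
      then show False using that s by simp
    qed
  qed
qed

text \<open>The Minkowski functional of an open convex neighbourhood \<open>A\<close> of \<open>C - c0\<close> is at least \<open>1\<close> at
  \<open>e - c0\<close>, and the linear functional below it that agrees with it there separates. The gap comes from
  the room that \<open>A\<close> leaves around \<open>C - c0\<close> in the direction of \<open>e - c0\<close>.\<close>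

lemma separate_point_closed_convex:
  fixes C :: "'a::locally_convex_space set"
  assumes C: "closed C" "convex C" and e: "e \<notin> C"
  shows "\<exists>l a. continuous_functional l \<and> (\<forall>x\<in>C. l x \<le> a) \<and> a < l e"
proof (cases "C = {}")
  case True
  then show ?thesis
    by (intro exI[of _ "\<lambda>x. 0"] exI[of _ "-1"]) (auto simp: linear_iff)
next
  case False
  then obtain c0 where c0: "c0 \<in> C" by blast
  have "open ((\<lambda>v. e - v) -` (- C))"
    using C by (intro open_vimage) (auto intro!: continuous_intros simp: open_Compl)
  then obtain V where V: "open V" "0 \<in> V" "convex V" "V \<subseteq> (\<lambda>v. e - v) -` (- C)"
    using ex_convex_open_nhds_0[of "(\<lambda>v. e - v) -` (- C)"] e by auto
  define A where "A = (\<Union>c\<in>C. (\<lambda>x. x - (c - c0)) -` V)"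
  have A_iff: "x \<in> A \<longleftrightarrow> (\<exists>c\<in>C. \<exists>v\<in>V. x = c + v - c0)" for x
  proof
    assume "x \<in> A"
    then obtain c where "c \<in> C" "x - (c - c0) \<in> V" unfolding A_def by auto
    then show "\<exists>c\<in>C. \<exists>v\<in>V. x = c + v - c0"
      by (intro bexI[of _ c] bexI[of _ "x - (c - c0)"]) auto
  next
    assume "\<exists>c\<in>C. \<exists>v\<in>V. x = c + v - c0"
    then obtain c v where cv: "c \<in> C" "v \<in> V" "x = c + v - c0" by blast
    then have "x - (c - c0) \<in> V" by simp
    then show "x \<in> A" unfolding A_def using cv(1) by blast
  qed
  have "open A"
    unfolding A_def
    by (intro open_UN ballI open_vimage V) (auto intro!: continuous_intros)
  moreover have "0 \<in> A"
    unfolding A_iff using c0 V(2) by (intro bexI[of _ c0] bexI[of _ 0]) auto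
  moreover have "convex A"
  proof (rule convexI)
    fix x y and u v :: real
    assume xy: "x \<in> A" "y \<in> A" and uv: "0 \<le> u" "0 \<le> v" "u + v = 1"
    from xy obtain c d p q where
      c: "c \<in> C" "d \<in> C" "p \<in> V" "q \<in> V" "x = c + p - c0" "y = d + q - c0"
      unfolding A_iff by blast
    have "u *\<^sub>R c0 + v *\<^sub>R c0 = c0" using uv by (simp flip: scaleR_add_left)
    then have "u *\<^sub>R x + v *\<^sub>R y = (u *\<^sub>R c + v *\<^sub>R d) + (u *\<^sub>R p + v *\<^sub>R q) - c0"
      unfolding c by (simp add: algebra_simps)
    then show "u *\<^sub>R x + v *\<^sub>R y \<in> A"
      unfolding A_iff using c convexD[OF C(2) c(1,2) uv] convexD[OF V(3) c(3,4) uv] by blast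
  qed
  ultimately have A: "open A" "0 \<in> A" "convex A" .
  have "e - c0 \<notin> A"
  proof
    assume "e - c0 \<in> A"
    then obtain c v where "c \<in> C" "v \<in> V" "e - c0 = c + v - c0" unfolding A_iff by blast
    then have "e - v = c" by (simp add: algebra_simps)
    then show False using \<open>c \<in> C\<close> \<open>v \<in> V\<close> V(4) by auto
  qed
  then have g: "1 \<le> minkowski_functional A (e - c0)" by (rule minkowski_functional_properties(3)[OF A])
  obtain l where l: "linear l" "\<forall>x. l x \<le> minkowski_functional A x" "l (e - c0) = minkowski_functional A (e - c0)"
    using Hahn_Banach_sublinear[OF minkowski_functional_properties(1)[OF A], of "e - c0"] by blast
  have lA: "l x \<le> 1" if "x \<in> A" for x
    using l(2) minkowski_functional_properties(2)[OF A that] by (meson order.trans)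
  have cont: "continuous_on UNIV l"
    by (rule linear_bounded_imp_continuous[OF l(1) A(1,2) lA])
  obtain s :: real where s: "s > 0" "s *\<^sub>R (e - c0) \<in> V"
    by (rule absorbing_nhds_0[OF V(1,2)])
  have pos: "s * l (e - c0) > 0"
    using s g l(3) by simp
  have "l c \<le> 1 + l c0 - s * l (e - c0)" if "c \<in> C" for c
  proof -
    have "c + s *\<^sub>R (e - c0) - c0 \<in> A" unfolding A_iff using that s by blast
    from lA[OF this] show ?thesis
      by (simp add: linear_add[OF l(1)] linear_diff[OF l(1)] linear_scale[OF l(1)])
  qed
  moreover have "1 + l c0 - s * l (e - c0) < l e"
    using pos g l(3) by (simp add: linear_diff[OF l(1)])
  ultimately show ?thesis using l(1) cont by blast
qed

section \<open>Minimal closed subsets of compact sets\<close>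

lemma compact_Zorn_minimal:
  fixes K :: "'a::t2_space set"
  assumes K: "compact K" "P K" 
    and chain: "\<And>\<C>. \<C> \<noteq> {} \<Longrightarrow> (\<And>L. L \<in> \<C> \<Longrightarrow> closed L \<and> L \<subseteq> K \<and> P L) \<Longrightarrow>
      (\<And>L M. L \<in> \<C> \<Longrightarrow> M \<in> \<C> \<Longrightarrow> L \<subseteq> M \<or> M \<subseteq> L) \<Longrightarrow> P (\<Inter>\<C>)"
  shows "\<exists>L. closed L \<and> L \<subseteq> K \<and> P L \<and> (\<forall>M. closed M \<and> M \<subseteq> L \<and> P M \<longrightarrow> M = L)"
proof -
  let ?A = "{L. closed L \<and> L \<subseteq> K \<and> P L}"
  let ?R = "\<lambda>L M :: 'a set. M \<subseteq> L"
  have "\<exists>L\<in>?A. \<forall>M\<in>?A. ?R L M \<longrightarrow> M = L"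
  proof (rule predicate_Zorn)
    show "partial_order_on ?A (relation_of ?R ?A)"
      by (rule partial_order_on_relation_ofI) blast+
  next
    fix \<C> assume "\<C> \<in> Chains (relation_of ?R ?A)"
    then have \<C>: "\<C> \<subseteq> ?A" and total: "\<And>L M. L \<in> \<C> \<Longrightarrow> M \<in> \<C> \<Longrightarrow> L \<subseteq> M \<or> M \<subseteq> L"
      unfolding Chains_def relation_of_def by blast+
    show "\<exists>U\<in>?A. \<forall>L\<in>\<C>. ?R L U"
    proof (cases "\<C> = {}")
      case True
      then show ?thesis using K compact_imp_closed[OF K(1)] by blast
    next
      case False
      have "P (\<Inter>\<C>)"
      proof (rule chain[OF False])
        show "closed L \<and> L \<subseteq> K \<and> P L" if "L \<in> \<C>" for L using that \<C> by blast
      qed (rule total)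
      moreover have "closed (\<Inter>\<C>)" using \<C> by (intro closed_Inter) auto
      moreover have "\<Inter>\<C> \<subseteq> K" using \<C> False by blast
      ultimately show ?thesis by blast
    qed
  qed
  then obtain L where L: "L \<in> ?A" "\<forall>M\<in>?A. M \<subseteq> L \<longrightarrow> M = L" by blast
  then have "\<forall>M. closed M \<and> M \<subseteq> L \<and> P M \<longrightarrow> M = L" by blast
  with L(1) show ?thesis by blast
qed

lemma compact_chain_Inter_nonempty:
  fixes K :: "'a::t2_space set"
  assumes K: "compact K" and ne: "\<C> \<noteq> {}"
    and \<C>: "\<And>L. L \<in> \<C> \<Longrightarrow> closed L \<and> L \<subseteq> K \<and> L \<noteq> {}"
    and ch: "\<And>L M. L \<in> \<C> \<Longrightarrow> M \<in> \<C> \<Longrightarrow> L \<subseteq> M \<or> M \<subseteq> L"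
  shows "\<Inter>\<C> \<noteq> {}"
proof -
  have "K \<inter> \<Inter>\<C> \<noteq> {}"
  proof (rule compact_imp_fip[OF K])
    fix F assume F: "finite F" "F \<subseteq> \<C>"
    show "K \<inter> \<Inter>F \<noteq> {}"
    proof (cases "F = {}")
      case True
      obtain L where "L \<in> \<C>" using ne by blast
      then show ?thesis using \<C>[of L] True by auto
    next
      case False
      then obtain L where L: "L \<in> F" "\<forall>M\<in>F. M \<subseteq> L \<longrightarrow> L = M"
        using finite_has_minimal[OF F(1)] by meson
      have "L \<subseteq> M" if "M \<in> F" for M
      proof -
        have "L \<in> \<C>" "M \<in> \<C>" using L(1) that F(2) by auto
        then have "L \<subseteq> M \<or> M \<subseteq> L" by (rule ch)
        then show ?thesis using L(2) that by blast
      qed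
      then have "L \<subseteq> \<Inter>F" by (rule Inter_greatest)
      moreover have "L \<subseteq> K" "L \<noteq> {}" using \<C>[of L] F(2) L(1) by auto
      ultimately show ?thesis by blast
    qed
  next
    show "closed L" if "L \<in> \<C>" for L using \<C>[OF that] by blast
  qed
  then show ?thesis by (rule contrapos_nn) simp
qed

section \<open>Closed convex hulls\<close>

definition cconv :: "'a::real_topological_vector set \<Rightarrow> 'a set" where
  "cconv K = closure (convex hull K)"

lemma closed_cconv: "closed (cconv K)"
  and convex_cconv: "convex (cconv K)"
  and subset_cconv: "K \<subseteq> cconv K"
  unfolding cconv_def
  using closure_subset[of "convex hull K"] hull_subset[of K convex]
  by (auto simp: convex_closure_tvs convex_convex_hull)

lemma cconv_minimal: "K \<subseteq> C \<Longrightarrow> closed C \<Longrightarrow> convex C \<Longrightarrow> cconv K \<subseteq> C"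
  unfolding cconv_def by (intro closure_minimal hull_minimal)

lemma cconv_mono: "K \<subseteq> L \<Longrightarrow> cconv K \<subseteq> cconv L"
  using subset_cconv[of L] by (intro cconv_minimal closed_cconv convex_cconv) auto

lemma compact_cconv:
  fixes X :: "'a::{real_topological_vector, t2_space} set"
  assumes "compact X" "convex X" "K \<subseteq> X"
  shows "cconv K \<subseteq> X" "compact (cconv K)"
proof -
  show *: "cconv K \<subseteq> X"
    using assms by (intro cconv_minimal compact_imp_closed)
  then have "X \<inter> cconv K = cconv K" by blast
  then show "compact (cconv K)"
    using compact_Int_closed[OF assms(1) closed_cconv, of K] by simp
qed

lemma closed_convex_halfspace:
  fixes l :: "'a::real_topological_vector \<Rightarrow> real"
  assumes "continuous_functional l"
  shows "closed {x. l x \<le> a}" "convex {x. l x \<le> a}" "closed {x. a \<le> l x}" "convex {x. a \<le> l x}"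
proof -
  have l: "linear l" and c: "continuous_on UNIV l" using assms by auto
  show "closed {x. l x \<le> a}" "closed {x. a \<le> l x}"
    using c by (auto intro!: closed_Collect_le continuous_intros)
  have eq: "l (u *\<^sub>R x + v *\<^sub>R y) = u * l x + v * l y" for u v x y
    by (simp add: linear_add[OF l] linear_scale[OF l])
  show "convex {x. l x \<le> a}"
    unfolding convex_def by (auto simp: eq intro: convex_bound_le)
  have "u * l x + v * l y \<ge> a" if "l x \<ge> a" "l y \<ge> a" "u \<ge> 0" "v \<ge> 0" "u + v = 1" for u v x y
    using convex_bound_le[of "- l x" "- a" "- l y" u v] that by simp
  then show "convex {x. a \<le> l x}"
    unfolding convex_def by (auto simp: eq)
qed

lemma cconv_functional_le:
  assumes "continuous_functional l" "\<And>k. k \<in> K \<Longrightarrow> l k \<le> a" "x \<in> cconv K"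
  shows "l x \<le> a"
proof -
  have "cconv K \<subseteq> {x. l x \<le> a}"
    by (rule cconv_minimal) (use assms(2) closed_convex_halfspace[OF assms(1)] in auto)
  then show ?thesis using assms(3) by auto
qed

lemma cconv_functional_ge:
  assumes "continuous_functional l" "\<And>k. k \<in> K \<Longrightarrow> a \<le> l k" "x \<in> cconv K"
  shows "a \<le> l x"
proof -
  have "cconv K \<subseteq> {x. a \<le> l x}"
    by (rule cconv_minimal) (use assms(2) closed_convex_halfspace[OF assms(1)] in auto)
  then show ?thesis using assms(3) by auto
qed

lemma separate_from_cconv:
  fixes K :: "'a::locally_convex_space set"
  assumes "e \<notin> cconv K"
  shows "\<exists>l a. continuous_functional l \<and> (\<forall>x\<in>cconv K. l x \<le> a) \<and> a < l e"
  by (rule separate_point_closed_convex[OF closed_cconv convex_cconv assms])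

text \<open>The segments joining two compact convex sets fill a compact convex set, so no closure has to be
  taken.\<close>

lemma cconv_Un_decompose:
  fixes X :: "'a::{real_topological_vector, t2_space} set"
  assumes X: "compact X" "convex X" and AB: "A \<subseteq> X" "B \<subseteq> X" "A \<noteq> {}" "B \<noteq> {}"
    and x: "x \<in> cconv (A \<union> B)"
  shows "\<exists>t\<in>{0..1}. \<exists>y\<in>cconv A. \<exists>z\<in>cconv B. x = t *\<^sub>R y + (1 - t) *\<^sub>R z"
proof -
  let ?g = "\<lambda>p. fst p *\<^sub>R fst (snd p) + (1 - fst p) *\<^sub>R snd (snd p)"
  define Z where "Z = ?g ` ({0..1::real} \<times> cconv A \<times> cconv B)"
  have Z_iff: "x \<in> Z \<longleftrightarrow> (\<exists>t\<in>{0..1}. \<exists>y\<in>cconv A. \<exists>z\<in>cconv B. x = t *\<^sub>R y + (1 - t) *\<^sub>R z)" for x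
    unfolding Z_def by force
  have "compact Z"
    unfolding Z_def
    by (intro compact_continuous_image compact_Times compact_Icc compact_cconv(2)[OF X] AB)
       (auto intro!: continuous_intros)
  then have "closed Z" by (rule compact_imp_closed)
  moreover have "convex Z"
  proof (rule convexI)
    fix x1 x2 and u v :: real
    assume x12: "x1 \<in> Z" "x2 \<in> Z" and uv: "0 \<le> u" "0 \<le> v" "u + v = 1"
    from x12(1) obtain s y1 z1 where 1: "0 \<le> s" "s \<le> 1" "y1 \<in> cconv A" "z1 \<in> cconv B"
      "x1 = s *\<^sub>R y1 + (1 - s) *\<^sub>R z1" unfolding Z_iff by auto
    from x12(2) obtain t y2 z2 where 2: "0 \<le> t" "t \<le> 1" "y2 \<in> cconv A" "z2 \<in> cconv B"
      "x2 = t *\<^sub>R y2 + (1 - t) *\<^sub>R z2" unfolding Z_iff by auto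
    have comb: "\<exists>w\<in>C. a *\<^sub>R w1 + b *\<^sub>R w2 = (a + b) *\<^sub>R w"
      if "convex C" "w1 \<in> C" "w2 \<in> C" "a \<ge> 0" "b \<ge> 0" for C and w1 w2 :: 'a and a b :: real
    proof (cases "a + b = 0")
      case True
      then have "a = 0" "b = 0" using that by auto
      then show ?thesis using that by auto
    next
      case False
      then have "(a / (a + b)) *\<^sub>R w1 + (b / (a + b)) *\<^sub>R w2 \<in> C"
        using that by (intro convexD[OF that(1)]) (auto simp flip: add_divide_distrib)
      moreover have "a *\<^sub>R w1 + b *\<^sub>R w2 = (a + b) *\<^sub>R ((a / (a + b)) *\<^sub>R w1 + (b / (a + b)) *\<^sub>R w2)"
        using False by (simp add: scaleR_add_right)
      ultimately show ?thesis by blast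
    qed
    obtain y where y: "y \<in> cconv A" "(u * s) *\<^sub>R y1 + (v * t) *\<^sub>R y2 = (u * s + v * t) *\<^sub>R y"
      using comb[OF convex_cconv 1(3) 2(3), of "u * s" "v * t"] uv 1 2 by auto
    obtain z where z: "z \<in> cconv B"
      "(u * (1 - s)) *\<^sub>R z1 + (v * (1 - t)) *\<^sub>R z2 = (u * (1 - s) + v * (1 - t)) *\<^sub>R z"
      using comb[OF convex_cconv 1(4) 2(4), of "u * (1 - s)" "v * (1 - t)"] uv 1 2 by auto
    have eq: "u * (1 - s) + v * (1 - t) = 1 - (u * s + v * t)"
      using uv by (simp add: algebra_simps)
    have "u *\<^sub>R x1 + v *\<^sub>R x2 = ((u * s) *\<^sub>R y1 + (v * t) *\<^sub>R y2)
        + ((u * (1 - s)) *\<^sub>R z1 + (v * (1 - t)) *\<^sub>R z2)"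
      unfolding 1 2 by (simp add: scaleR_add_right)
    also have "\<dots> = (u * s + v * t) *\<^sub>R y + (1 - (u * s + v * t)) *\<^sub>R z"
      unfolding y(2) z(2) eq ..
    finally have "u *\<^sub>R x1 + v *\<^sub>R x2 = (u * s + v * t) *\<^sub>R y + (1 - (u * s + v * t)) *\<^sub>R z" .
    moreover have "u * s + v * t \<in> {0..1}"
      using uv 1 2 convex_bound_le[of s 1 t u v] by auto
    ultimately show "u *\<^sub>R x1 + v *\<^sub>R x2 \<in> Z" unfolding Z_iff using y z by blast
  qed
  moreover have "A \<union> B \<subseteq> Z"
  proof -
    obtain a b where ab: "a \<in> cconv A" "b \<in> cconv B"
      using AB subset_cconv[of A] subset_cconv[of B] by blast
    have "x \<in> Z" if "x \<in> A" for x
      unfolding Z_iff using that subset_cconv[of A] ab by (intro bexI[of _ 1] bexI[of _ x] bexI[of _ b]) auto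
    moreover have "x \<in> Z" if "x \<in> B" for x
      unfolding Z_iff using that subset_cconv[of B] ab by (intro bexI[of _ 0] bexI[of _ a] bexI[of _ x]) auto
    ultimately show ?thesis by blast
  qed
  ultimately show ?thesis using cconv_minimal[of "A \<union> B" Z] x Z_iff by blast
qed

text \<open>Zorn's lemma applies because generation is a compactness property: if a closed half space around
  \<open>q\<close> missed \<open>B\<close> and the intersection of a chain, then it would already miss some member of the
  chain, which then could not generate \<open>q\<close> together with \<open>B\<close>.\<close>

lemma exists_minimal_generating_set:
  fixes K :: "'a::{locally_convex_space, t2_space} set"
  assumes K: "compact K" and S: "S \<subseteq> cconv (B \<union> K)"
  shows "\<exists>L. closed L \<and> L \<subseteq> K \<and> S \<subseteq> cconv (B \<union> L) \<and>
    (\<forall>M. closed M \<and> M \<subseteq> L \<and> S \<subseteq> cconv (B \<union> M) \<longrightarrow> M = L)"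
proof (rule compact_Zorn_minimal[where P = "\<lambda>L. S \<subseteq> cconv (B \<union> L)", OF K S])
  fix \<C> assume ne: "\<C> \<noteq> {}"
    and \<C>: "\<And>L. L \<in> \<C> \<Longrightarrow> closed L \<and> L \<subseteq> K \<and> S \<subseteq> cconv (B \<union> L)"
    and total: "\<And>L M. L \<in> \<C> \<Longrightarrow> M \<in> \<C> \<Longrightarrow> L \<subseteq> M \<or> M \<subseteq> L"
  show "S \<subseteq> cconv (B \<union> \<Inter>\<C>)"
  proof
    fix q assume q: "q \<in> S"
    show "q \<in> cconv (B \<union> \<Inter>\<C>)"
    proof (rule ccontr)
      assume "q \<notin> cconv (B \<union> \<Inter>\<C>)"
      then obtain l a where l: "continuous_functional l" and le: "\<forall>x\<in>cconv (B \<union> \<Inter>\<C>). l x \<le> a"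
        and aq: "a < l q"
        using separate_from_cconv by blast
      have le': "l x \<le> a" if "x \<in> B \<union> \<Inter>\<C>" for x
        using le that subset_cconv[of "B \<union> \<Inter>\<C>"] by blast
      obtain a' where a': "a < a'" "a' < l q" using dense[OF aq] by blast
      define H where "H = {x. a' \<le> l x}"
      have H: "closed H" unfolding H_def by (rule closed_convex_halfspace(3)[OF l])
      have "\<Inter>((\<lambda>L. L \<inter> H) ` \<C>) \<noteq> {}"
      proof (rule compact_chain_Inter_nonempty[OF K])
        show "(\<lambda>L. L \<inter> H) ` \<C> \<noteq> {}" using ne by simp
      next
        fix M assume "M \<in> (\<lambda>L. L \<inter> H) ` \<C>"
        then obtain L where L: "L \<in> \<C>" "M = L \<inter> H" by blast
        have "L \<inter> H \<noteq> {}"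
        proof
          assume empty: "L \<inter> H = {}"
          have "l x \<le> a'" if "x \<in> B \<union> L" for x
            using that le'[of x] a'(1) empty unfolding H_def by auto
          then have "l q \<le> a'"
            by (rule cconv_functional_le[OF l]) (use \<C>[OF L(1)] q in blast)+
          then show False using a' by simp
        qed
        then show "closed M \<and> M \<subseteq> K \<and> M \<noteq> {}" using \<C>[OF L(1)] H unfolding L(2) by auto
      next
        fix M N assume "M \<in> (\<lambda>L. L \<inter> H) ` \<C>" "N \<in> (\<lambda>L. L \<inter> H) ` \<C>"
        then obtain L L' where "L \<in> \<C>" "L' \<in> \<C>" "M = L \<inter> H" "N = L' \<inter> H" by blast
        then show "M \<subseteq> N \<or> N \<subseteq> M" using total[of L L'] by blast
      qed
      then obtain x where x: "x \<in> \<Inter>((\<lambda>L. L \<inter> H) ` \<C>)" by blast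
      then have "x \<in> \<Inter>\<C>" "x \<in> H" using ne by auto
      then show False using le'[of x] a'(1) unfolding H_def by auto
    qed
  qed
qed

section \<open>Affine functions and points of continuity\<close>

lemma affine_fun_onD:
  "affine_fun_on X f \<Longrightarrow> x \<in> X \<Longrightarrow> y \<in> X \<Longrightarrow> 0 \<le> t \<Longrightarrow> t \<le> 1 \<Longrightarrow>
    f (t *\<^sub>R x + (1 - t) *\<^sub>R y) = t * f x + (1 - t) * f y"
  unfolding affine_fun_on_def by auto

lemma affine_fun_on_subset: "affine_fun_on X f \<Longrightarrow> Y \<subseteq> X \<Longrightarrow> affine_fun_on Y f"
  unfolding affine_fun_on_def by blast

lemma pcp_obtain_point:
  assumes "point_of_continuity_property X f" "closed F" "F \<subseteq> X" "F \<noteq> {}"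
  shows "\<exists>x\<in>F. continuous (at x within F) f"
  using assms unfolding point_of_continuity_property_def by (meson closed_subset)

lemma continuous_within_nhd:
  fixes f :: "'a::t2_space \<Rightarrow> real"
  assumes "continuous (at x within F) f" "0 < e"
  shows "\<exists>W. open W \<and> x \<in> W \<and> (\<forall>y\<in>W \<inter> F. \<bar>f y - f x\<bar> < e)"
proof -
  have "\<forall>\<^sub>F y in at x within F. dist (f y) (f x) < e"
    using assms unfolding continuous_within by (auto dest: tendstoD)
  then obtain W where "open W" "x \<in> W" "\<forall>y\<in>W. y \<noteq> x \<longrightarrow> y \<in> F \<longrightarrow> dist (f y) (f x) < e"
    unfolding eventually_at_topological by blast
  then show ?thesis using assms(2) by (intro exI[of _ W]) (auto simp: dist_real_def)
qed

text \<open>Near a point of continuity \<open>p\<close> the function is bounded, and by compactness a single homothety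
  with centre \<open>p\<close> moves all of \<open>X\<close> into such a neighbourhood.\<close>

lemma affine_pcp_imp_bounded:
  fixes X :: "'a::{real_topological_vector, t2_space} set"
  assumes X: "compact X" "convex X" and f: "affine_fun_on X f" "point_of_continuity_property X f"
  shows "\<exists>B>0. \<forall>x\<in>X. \<bar>f x\<bar> \<le> B"
proof (cases "X = {}")
  case True
  then show ?thesis by (intro exI[of _ 1]) auto
next
  case False
  obtain p where p: "p \<in> X" "continuous (at p within X) f"
    using pcp_obtain_point[OF f(2) compact_imp_closed[OF X(1)] _ False] by blast
  obtain W where W: "open W" "p \<in> W" "\<forall>y\<in>W \<inter> X. \<bar>f y - f p\<bar> < 1"
    using continuous_within_nhd[OF p(2), of 1] by auto
  define g where "g q = fst q *\<^sub>R snd q + (1 - fst q) *\<^sub>R p" for q :: "real \<times> 'a"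
  have "open (g -` W)"
    using W(1) unfolding g_def by (intro open_vimage) (auto intro!: continuous_intros)
  then have "\<exists>U V. openin euclidean U \<and> openin euclidean V \<and> (0::real) \<in> U \<and> X \<subseteq> V \<and> U \<times> V \<subseteq> g -` W"
    using X(1) W(2) by (intro tube_lemma_right) (auto simp: euclidean_product_topology g_def)
  then obtain U V where U: "open U" "(0::real) \<in> U" "X \<subseteq> V" "U \<times> V \<subseteq> g -` W"
    by (auto simp flip: open_openin)
  obtain e where e: "e > 0" "ball 0 e \<subseteq> U" using U(1,2) open_contains_ball by blast
  define t where "t = min (e / 2) (1 / 2)"
  have "t > 0" "t < 1" "t < e" using e(1) unfolding t_def by auto
  then have t: "t \<in> U" "t > 0" "t < 1" using e(2) by (auto simp: subset_iff)
  have "\<bar>f x\<bar> \<le> \<bar>f p\<bar> + 1 / t" if x: "x \<in> X" for x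
  proof -
    let ?y = "t *\<^sub>R x + (1 - t) *\<^sub>R p"
    have "?y \<in> X" using convexD[OF X(2) x p(1), of t "1 - t"] t by simp
    moreover have "(t, x) \<in> g -` W" using U(3,4) t(1) x by blast
    then have "?y \<in> W" by (simp add: g_def)
    ultimately have "\<bar>f ?y - f p\<bar> < 1" using W(3) by blast
    also have "f ?y - f p = t * (f x - f p)"
      using affine_fun_onD[OF f(1) x p(1), of t] t by (simp add: algebra_simps)
    also have "\<bar>t * (f x - f p)\<bar> = t * \<bar>f x - f p\<bar>" using t by (simp add: abs_mult)
    finally have "\<bar>f x - f p\<bar> < 1 / t" using t by (simp only: pos_less_divide_eq mult.commute)
    then show ?thesis by linarith
  qed
  moreover have "\<bar>f p\<bar> + 1 / t > 0" using t by (simp add: add_nonneg_pos)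
  ultimately show ?thesis by blast
qed

section \<open>Exhaustion by convex combinations\<close>

text \<open>Replacing a part of \<open>x\<close> by a decomposition of that part multiplies the weights.\<close>

lemma combine_decompositions:
  fixes H :: "'a::real_vector set"
  assumes H: "convex H" "a \<in> H" "b \<in> H" and t: "0 \<le> s" "s < 1" "0 \<le> r" "r < 1"
    and x: "x = (1 - r) *\<^sub>R a + r *\<^sub>R ((1 - s) *\<^sub>R b + s *\<^sub>R c)"
  shows "\<exists>w\<in>H. x = (1 - r * s) *\<^sub>R w + (r * s) *\<^sub>R c"
proof -
  have "r * s \<le> r * 1" using t by (intro mult_left_mono) auto
  then have pos: "1 - r * s > 0" using t by simp
  define w where "w = ((1 - r) / (1 - r * s)) *\<^sub>R a + (r * (1 - s) / (1 - r * s)) *\<^sub>R b"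
  have "(1 - r) / (1 - r * s) + r * (1 - s) / (1 - r * s) = 1"
    using pos by (simp add: right_diff_distrib flip: add_divide_distrib)
  then have "w \<in> H"
    unfolding w_def using pos t by (intro convexD[OF H]) auto
  moreover have "(1 - r * s) *\<^sub>R w = (1 - r) *\<^sub>R a + (r * (1 - s)) *\<^sub>R b"
    unfolding w_def using pos by (simp add: scaleR_add_right)
  then have "x = (1 - r * s) *\<^sub>R w + (r * s) *\<^sub>R c"
    unfolding x by (simp add: scaleR_add_right)
  ultimately show ?thesis by blast
qed

text \<open>If \<open>f x > d\<close>, a greedy procedure writes \<open>x\<close> as a part on which \<open>f \<le> d\<close> plus a remainder
  \<open>z n\<close>, removing at each step at least half of what can be removed. Since \<open>f\<close> is bounded above
  and \<open>f x > d\<close>, there is \<open>r > 0\<close> such that \<open>z m\<close> is a part of \<open>z n\<close> of weight \<open>r\<close> for all \<open>m \<ge> n\<close>. A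
  cluster point \<open>c\<close> of the remainders is therefore a part of weight \<open>r\<close> of every \<open>z n\<close>. A part \<open>t y\<close>
  can be removed from \<open>c\<close>, hence the part \<open>r t y\<close> from every \<open>z n\<close>; so every step removes at least
  \<open>r t / 2\<close>, and \<open>f (z n) - d\<close> grows geometrically, contradicting boundedness.\<close>

lemma affine_le_by_exhaustion:
  fixes H :: "'a::{real_topological_vector, t2_space} set"
  assumes H: "compact H" "convex H" and f: "affine_fun_on H f" and B: "\<And>x. x \<in> H \<Longrightarrow> f x \<le> B"
    and part: "\<And>x. x \<in> H \<Longrightarrow>
      \<exists>t y z. 0 < t \<and> t \<le> 1 \<and> y \<in> H \<and> z \<in> H \<and> f y \<le> d \<and> x = t *\<^sub>R y + (1 - t) *\<^sub>R z"
    and x: "x \<in> H"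
  shows "f x \<le> d"
proof (rule ccontr)
  assume "\<not> f x \<le> d"
  then have fx: "d < f x" by simp
  define T where "T x = {t. 0 < t \<and> t \<le> 1 \<and> (\<exists>y\<in>H. \<exists>z\<in>H. f y \<le> d \<and> x = t *\<^sub>R y + (1 - t) *\<^sub>R z)}" for x
  have T_ne: "T x \<noteq> {}" if "x \<in> H" for x using part[OF that] unfolding T_def by blast
  have T_le: "t \<le> 1" if "t \<in> T x" for t x using that unfolding T_def by auto
  have T_bdd: "bdd_above (T x)" for x using T_le by (intro bdd_aboveI) auto
  define S where "S x = Sup (T x)" for x
  have T_S: "t \<le> S x" if "t \<in> T x" for t x
    unfolding S_def by (rule cSup_upper[OF that T_bdd])
  have step: "\<exists>z'. (z' \<in> H \<and> d < f z') \<and> (\<exists>t y. 0 < t \<and> t < 1 \<and> y \<in> H \<and> f y \<le> d \<and>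
      z = t *\<^sub>R y + (1 - t) *\<^sub>R z' \<and> S z \<le> 2 * t)"
    if z: "z \<in> H \<and> d < f z" for z
  proof -
    obtain t0 where t0: "t0 \<in> T z" using T_ne z by blast
    then have "0 < S z" using T_S[OF t0] unfolding T_def by auto
    then have "S z / 2 < S z" by simp
    then obtain t where t: "t \<in> T z" "S z / 2 < t"
      using less_cSup_iff[OF T_ne T_bdd, of z] z unfolding S_def by blast
    then obtain y z' where y: "0 < t" "t \<le> 1" "y \<in> H" "z' \<in> H" "f y \<le> d"
      "z = t *\<^sub>R y + (1 - t) *\<^sub>R z'" unfolding T_def by blast
    have fz: "f z = t * f y + (1 - t) * f z'"
      using affine_fun_onD[OF f y(3,4), of t] y by simp
    have "t \<noteq> 1" using fz y(5) z by auto
    then have "t < 1" using y(2) by simp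
    have "t * f y \<le> t * d" using y by simp
    then have "(1 - t) * d < (1 - t) * f z'" using fz z by (simp add: algebra_simps)
    then have "d < f z'" using \<open>t < 1\<close> by simp
    then show ?thesis using y t \<open>t < 1\<close> by (intro exI[of _ z'] conjI exI[of _ t] exI[of _ y]) auto
  qed
  obtain z where z: "\<And>n. z n \<in> H" "\<And>n. d < f (z n)" "z 0 = x"
    and zS: "\<And>n. \<exists>t y. 0 < t \<and> t < 1 \<and> y \<in> H \<and> f y \<le> d \<and>
      z n = t *\<^sub>R y + (1 - t) *\<^sub>R z (Suc n) \<and> S (z n) \<le> 2 * t"
  proof -
    define nx where "nx z = (SOME z'. (z' \<in> H \<and> d < f z') \<and> (\<exists>t y. 0 < t \<and> t < 1 \<and> y \<in> H \<and> f y \<le> d \<and>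
      z = t *\<^sub>R y + (1 - t) *\<^sub>R z' \<and> S z \<le> 2 * t))" for z
    have nx: "(nx z \<in> H \<and> d < f (nx z)) \<and> (\<exists>t y. 0 < t \<and> t < 1 \<and> y \<in> H \<and> f y \<le> d \<and>
      z = t *\<^sub>R y + (1 - t) *\<^sub>R nx z \<and> S z \<le> 2 * t)" if "z \<in> H \<and> d < f z" for z
      unfolding nx_def by (rule someI_ex[OF step[OF that]])
    define w where "w n = (nx ^^ n) x" for n
    have w: "w n \<in> H \<and> d < f (w n)" for n
      by (induction n) (use x fx nx in \<open>auto simp: w_def\<close>)
    have "w (Suc n) = nx (w n)" for n unfolding w_def by simp
    then show thesis using that[of w] w nx[OF w] by (simp add: w_def)
  qed
  have zt: "\<exists>t y. 0 < t \<and> t < 1 \<and> y \<in> H \<and> z n = t *\<^sub>R y + (1 - t) *\<^sub>R z (Suc n) \<and>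
      S (z n) \<le> 2 * t \<and> f (z n) - d \<le> (1 - t) * (f (z (Suc n)) - d)" for n
  proof -
    obtain t y where t: "0 < t" "t < 1" "y \<in> H" "f y \<le> d"
      "z n = t *\<^sub>R y + (1 - t) *\<^sub>R z (Suc n)" "S (z n) \<le> 2 * t" using zS by blast
    have "f (z n) = t * f y + (1 - t) * f (z (Suc n))"
      using affine_fun_onD[OF f t(3) z(1)[of "Suc n"], of t] t by simp
    moreover have "t * f y \<le> t * d" using t by simp
    ultimately have "f (z n) - d \<le> (1 - t) * (f (z (Suc n)) - d)" by (simp add: algebra_simps)
    then show ?thesis using t by (intro exI[of _ t] exI[of _ y]) simp
  qed
  have mono: "f (z n) \<le> f (z (Suc n)) \<and> (f (z n) - d) * (1 + S (z n) / 2) \<le> f (z (Suc n)) - d" for n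
  proof -
    obtain t where t: "0 < t" "t < 1" "S (z n) \<le> 2 * t"
      and le: "f (z n) - d \<le> (1 - t) * (f (z (Suc n)) - d)" using zt by blast
    have pos: "0 < f (z n) - d" "0 < f (z (Suc n)) - d" using z(2)[of n] z(2)[of "Suc n"] by auto
    have "(f (z n) - d) * (1 + S (z n) / 2) \<le> (f (z n) - d) * (1 + t)"
      using t pos by (intro mult_left_mono) auto
    also have "\<dots> \<le> ((1 - t) * (f (z (Suc n)) - d)) * (1 + t)"
      using le t by (intro mult_right_mono) auto
    also have "\<dots> = (1 - t * t) * (f (z (Suc n)) - d)" by (simp add: algebra_simps)
    also have "\<dots> \<le> 1 * (f (z (Suc n)) - d)"
      using pos t by (intro mult_right_mono) auto
    finally have "(f (z n) - d) * (1 + S (z n) / 2) \<le> f (z (Suc n)) - d" by simp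
    moreover have "(1 - t) * (f (z (Suc n)) - d) \<le> 1 * (f (z (Suc n)) - d)"
      using pos t by (intro mult_right_mono) auto
    then have "f (z n) \<le> f (z (Suc n))" using le by simp
    ultimately show ?thesis by blast
  qed
  have inc: "f x \<le> f (z n)" for n
    by (induction n) (use mono z(3) order.trans in auto)
  have "d < B" using B[OF x] fx by simp
  \<comment> \<open>The weight of \<open>z m\<close> in an earlier \<open>z n\<close> is at least \<open>(f x - d) / (B - d)\<close>; half of that is also less than \<open>1\<close>.\<close>
  define r where "r = ((f x - d) / (B - d)) / 2"
  have r: "0 < r" "r < 1"
    using fx B[OF x] unfolding r_def by (auto simp: field_simps)
  have tail: "\<exists>s w. 0 \<le> s \<and> s \<le> 1 \<and> w \<in> H \<and> z n = (1 - s) *\<^sub>R w + s *\<^sub>R z (n + k) \<and>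
      f (z n) - d \<le> s * (f (z (n + k)) - d)" for n k
  proof (induction k)
    case 0
    show ?case using z(1)[of n] by (intro exI[of _ 1] exI[of _ "z n"]) auto
  next
    case (Suc k)
    then obtain s w where s: "0 \<le> s" "s \<le> 1" "w \<in> H" "z n = (1 - s) *\<^sub>R w + s *\<^sub>R z (n + k)"
      "f (z n) - d \<le> s * (f (z (n + k)) - d)" by blast
    obtain t y where t: "0 < t" "t < 1" "y \<in> H"
      "z (n + k) = t *\<^sub>R y + (1 - t) *\<^sub>R z (Suc (n + k))"
      and le: "f (z (n + k)) - d \<le> (1 - t) * (f (z (Suc (n + k))) - d)" using zt by blast
    have "s * (f (z (n + k)) - d) \<le> s * ((1 - t) * (f (z (Suc (n + k))) - d))"
      using le s by (intro mult_left_mono)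
    then have 1: "f (z n) - d \<le> (s * (1 - t)) * (f (z (Suc (n + k))) - d)"
      using s(5) by (simp add: mult.assoc)
    have "\<exists>w'\<in>H. z n = (1 - s * (1 - t)) *\<^sub>R w' + (s * (1 - t)) *\<^sub>R z (Suc (n + k))"
    proof (cases "s = 1")
      case True
      then show ?thesis using s(4) t by (intro bexI[of _ y]) auto
    next
      case False
      then show ?thesis
        using s t by (intro combine_decompositions[OF H(2) s(3) t(3), of "1 - t" s]) auto
    qed
    then obtain w' where "w' \<in> H" "z n = (1 - s * (1 - t)) *\<^sub>R w' + (s * (1 - t)) *\<^sub>R z (Suc (n + k))"
      by blast
    moreover have "0 \<le> s * (1 - t)" "s * (1 - t) \<le> 1" using s t by (auto intro: mult_le_one)
    ultimately show ?case using 1 by (intro exI[of _ "s * (1 - t)"] exI[of _ w']) auto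
  qed
  \<comment> \<open>Any larger weight may be reduced to \<open>r\<close>; with the same weight for all \<open>k\<close> one can pass to the limit.\<close>
  have tail_r: "\<exists>w\<in>H. z n = (1 - r) *\<^sub>R w + r *\<^sub>R z (n + k)" for n k
  proof -
    obtain s w where s: "0 \<le> s" "s \<le> 1" "w \<in> H" "z n = (1 - s) *\<^sub>R w + s *\<^sub>R z (n + k)"
      "f (z n) - d \<le> s * (f (z (n + k)) - d)" using tail by blast
    have "f x - d \<le> f (z n) - d" using inc[of n] by simp
    also have "\<dots> \<le> s * (B - d)" using s B[OF z(1), of "n + k"]
      by (meson diff_right_mono mult_left_mono order.trans)
    finally have "(f x - d) / (B - d) \<le> s" using \<open>d < B\<close> by (simp add: pos_divide_le_eq)
    moreover have "(f x - d) / (B - d) = 2 * r"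
      unfolding r_def by (metis field_sum_of_halves mult_2)
    ultimately have rs: "r < s" using r by simp
    define w' where "w' = ((1 - s) / (1 - r)) *\<^sub>R w + ((s - r) / (1 - r)) *\<^sub>R z (n + k)"
    have "w' \<in> H" unfolding w'_def
      using r s(1-3) rs z(1)[of "n + k"] by (intro convexD[OF H(2)]) (auto simp flip: add_divide_distrib)
    moreover have "(1 - r) *\<^sub>R w' = (1 - s) *\<^sub>R w + (s - r) *\<^sub>R z (n + k)"
      unfolding w'_def using r by (simp add: scaleR_add_right)
    then have "z n = (1 - r) *\<^sub>R w' + r *\<^sub>R z (n + k)"
      using s(4) by (simp add: scaleR_diff_left)
    ultimately show ?thesis by blast
  qed
  obtain c where c: "c \<in> H" "\<And>n. c \<in> closure {z m |m. n \<le> m}"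
  proof -
    have "H \<inter> (\<Inter>n\<in>UNIV. closure {z m |m. n \<le> m}) \<noteq> {}"
    proof (rule compact_imp_fip_image[OF H(1)])
      fix I :: "nat set" assume I: "finite I"
      have "z (Max (insert 0 I)) \<in> closure {z m |m. n \<le> m}" if "n \<in> I" for n
        by (rule subsetD[OF closure_subset]) (use I that in \<open>auto intro!: exI[of _ "Max (insert 0 I)"]\<close>)
      then show "H \<inter> (\<Inter>n\<in>I. closure {z m |m. n \<le> m}) \<noteq> {}" using z(1) by blast
    qed auto
    then show thesis using that by blast
  qed
  obtain t y z' where t: "0 < t" "t \<le> 1" "y \<in> H" "z' \<in> H" "f y \<le> d" "c = t *\<^sub>R y + (1 - t) *\<^sub>R z'"
    using part[OF c(1)] by blast
  have S: "r * t \<le> S (z n)" for n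
  proof -
    define D where "D = {v. (1 / (1 - r)) *\<^sub>R (z n - r *\<^sub>R v) \<in> H}"
    have "D = (\<lambda>v. (1 / (1 - r)) *\<^sub>R (z n - r *\<^sub>R v)) -` H" unfolding D_def by auto
    then have "closed D"
      using compact_imp_closed[OF H(1)] by (auto intro!: closed_vimage continuous_intros)
    moreover have "{z m |m. n \<le> m} \<subseteq> D"
    proof clarify
      fix m assume "n \<le> m"
      then obtain k where "m = n + k" using le_Suc_ex by blast
      then obtain w where w: "w \<in> H" "z n = (1 - r) *\<^sub>R w + r *\<^sub>R z m" using tail_r by blast
      then have "(1 / (1 - r)) *\<^sub>R (z n - r *\<^sub>R z m) = w" using r by simp
      then show "z m \<in> D" unfolding D_def using w by simp
    qed
    ultimately have "c \<in> D" using c(2)[of n] closure_minimal by blast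
    define w where "w = (1 / (1 - r)) *\<^sub>R (z n - r *\<^sub>R c)"
    have w: "w \<in> H" using \<open>c \<in> D\<close> unfolding D_def w_def by simp
    have "(1 - r) *\<^sub>R w = z n - r *\<^sub>R c" unfolding w_def using r by simp
    then have "z n = (1 - r) *\<^sub>R w + r *\<^sub>R ((1 - t) *\<^sub>R z' + t *\<^sub>R y)"
      unfolding t(6) by (simp add: algebra_simps)
    moreover have "\<exists>v\<in>H. z n = (1 - r * t) *\<^sub>R v + (r * t) *\<^sub>R y"
    proof (cases "t = 1")
      case True
      then show ?thesis using calculation w by (intro bexI[of _ w]) auto
    next
      case False
      then show ?thesis
        using calculation r t by (intro combine_decompositions[OF H(2) w t(4)]) auto
    qed
    then obtain v where "v \<in> H" "z n = (r * t) *\<^sub>R y + (1 - r * t) *\<^sub>R v"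
      by (auto simp: add.commute)
    moreover have "0 < r * t" "r * t \<le> 1" using r t by (auto intro: mult_le_one)
    ultimately have "r * t \<in> T (z n)" unfolding T_def using t(3,5) by blast
    then show ?thesis by (rule T_S)
  qed
  define q where "q = 1 + r * t / 2"
  have q: "q > 1" unfolding q_def using r t by simp
  have "(f x - d) * q ^ n \<le> f (z n) - d" for n
  proof (induction n)
    case (Suc n)
    have "(f x - d) * q ^ Suc n = ((f x - d) * q ^ n) * q" by simp
    also have "\<dots> \<le> (f (z n) - d) * q" using Suc q by (intro mult_right_mono) auto
    also have "\<dots> \<le> (f (z n) - d) * (1 + S (z n) / 2)"
      unfolding q_def using S[of n] z(2)[of n] by (intro mult_left_mono) auto
    also have "\<dots> \<le> f (z (Suc n)) - d" using mono by blast
    finally show ?case .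
  qed (simp add: z)
  moreover obtain n where "(B - d) / (f x - d) < q ^ n"
    using real_arch_pow[OF q] by blast
  then have "B - d < (f x - d) * q ^ n" using fx by (simp add: field_simps)
  ultimately show False using B[OF z(1), of n] by (smt (verit))
qed

section \<open>Bounds on closed sets pass to closed convex hulls\<close>

lemma shrink_weight:
  fixes H :: "'a::real_vector set"
  assumes H: "convex H" "y \<in> H" "z \<in> H" and s: "0 < s" "s < t" "t \<le> 1"
    and x: "x = t *\<^sub>R y + (1 - t) *\<^sub>R z"
  shows "\<exists>z'\<in>H. x = s *\<^sub>R y + (1 - s) *\<^sub>R z'"
proof -
  define z' where "z' = ((t - s) / (1 - s)) *\<^sub>R y + ((1 - t) / (1 - s)) *\<^sub>R z"
  have "z' \<in> H"
    unfolding z'_def using s by (intro convexD[OF H]) (auto simp flip: add_divide_distrib)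
  moreover have "(1 - s) *\<^sub>R z' = (t - s) *\<^sub>R y + (1 - t) *\<^sub>R z"
    unfolding z'_def using s by (simp add: scaleR_add_right)
  then have "x = s *\<^sub>R y + (1 - s) *\<^sub>R z'"
    unfolding x by (simp add: scaleR_diff_left)
  ultimately show ?thesis by blast
qed

text \<open>For convex \<open>H\<close> and \<open>x \<in> H\<close>, the smallest face of \<open>H\<close> that contains \<open>x\<close>; it is usually not closed.\<close>

definition generated_face :: "'a::real_vector set \<Rightarrow> 'a \<Rightarrow> 'a set" where
  "generated_face H x =
    {y \<in> H. \<exists>t z. 0 < t \<and> t \<le> 1 \<and> z \<in> H \<and> x = t *\<^sub>R y + (1 - t) *\<^sub>R z}"

lemma convex_generated_face:
  assumes H: "convex H"
  shows "convex (generated_face H x)"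
proof (rule convexI)
  fix y1 y2 and u v :: real
  assume y: "y1 \<in> generated_face H x" "y2 \<in> generated_face H x" and uv: "0 \<le> u" "0 \<le> v" "u + v = 1"
  from y(1) obtain t1 z1 where 1: "y1 \<in> H" "0 < t1" "t1 \<le> 1" "z1 \<in> H" "x = t1 *\<^sub>R y1 + (1 - t1) *\<^sub>R z1"
    unfolding generated_face_def by blast
  from y(2) obtain t2 z2 where 2: "y2 \<in> H" "0 < t2" "t2 \<le> 1" "z2 \<in> H" "x = t2 *\<^sub>R y2 + (1 - t2) *\<^sub>R z2"
    unfolding generated_face_def by blast
  define s where "s = min t1 t2 / 2"
  have s: "0 < s" "s < t1" "s < t2" "s \<le> 1" using 1 2 unfolding s_def by auto
  obtain w1 where w1: "w1 \<in> H" "x = s *\<^sub>R y1 + (1 - s) *\<^sub>R w1"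
    using shrink_weight[OF H 1(1,4) s(1,2) 1(3,5)] by blast
  obtain w2 where w2: "w2 \<in> H" "x = s *\<^sub>R y2 + (1 - s) *\<^sub>R w2"
    using shrink_weight[OF H 2(1,4) s(1,3) 2(3,5)] by blast
  have "x = u *\<^sub>R x + v *\<^sub>R x" using uv by (simp flip: scaleR_add_left)
  also have "\<dots> = u *\<^sub>R (s *\<^sub>R y1 + (1 - s) *\<^sub>R w1) + v *\<^sub>R (s *\<^sub>R y2 + (1 - s) *\<^sub>R w2)"
    using w1(2) w2(2) by simp
  also have "\<dots> = s *\<^sub>R (u *\<^sub>R y1 + v *\<^sub>R y2) + (1 - s) *\<^sub>R (u *\<^sub>R w1 + v *\<^sub>R w2)"
    by (simp add: scaleR_add_right mult.commute)
  finally have "x = s *\<^sub>R (u *\<^sub>R y1 + v *\<^sub>R y2) + (1 - s) *\<^sub>R (u *\<^sub>R w1 + v *\<^sub>R w2)" .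
  moreover have "u *\<^sub>R y1 + v *\<^sub>R y2 \<in> H" "u *\<^sub>R w1 + v *\<^sub>R w2 \<in> H"
    using convexD[OF H _ _ uv] 1(1) 2(1) w1(1) w2(1) by blast+
  ultimately show "u *\<^sub>R y1 + v *\<^sub>R y2 \<in> generated_face H x"
    unfolding generated_face_def using s by blast
qed

text \<open>By minimality, for any half space around \<open>k \<in> L\<close>, the rest of \<open>L\<close> does not generate \<open>x\<close>. Thus
  a part of \<open>x\<close> of positive weight lies in the half space, and this part is in the face generated by
  \<open>x\<close>. So no half space separates \<open>k\<close> from the face.\<close>

lemma generated_face_dense:
  fixes L :: "'a::{locally_convex_space, t2_space} set"
  assumes X: "compact X" "convex X" and L: "closed L" "L \<subseteq> X" "x \<in> cconv L"
    and min: "\<And>M. closed M \<Longrightarrow> M \<subseteq> L \<Longrightarrow> x \<in> cconv M \<Longrightarrow> M = L"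
  shows "cconv L \<subseteq> closure (generated_face (cconv L) x)"
proof (rule cconv_minimal)
  let ?D = "closure (generated_face (cconv L) x)"
  show "closed ?D" by simp
  show conv: "convex ?D" by (intro convex_closure_tvs convex_generated_face convex_cconv)
  show "L \<subseteq> ?D"
  proof
    fix k assume k: "k \<in> L"
    show "k \<in> ?D"
    proof (rule ccontr)
      assume "k \<notin> ?D"
      then obtain l a where l: "continuous_functional l" and le: "\<forall>y\<in>?D. l y \<le> a" and ak: "a < l k"
        using separate_point_closed_convex[OF closed_closure conv] by blast
      obtain b where b: "a < b" "b < l k" using dense[OF ak] by blast
      have face: "l y \<le> a" if "y \<in> generated_face (cconv L) x" for y
        using le that closure_subset by blast
      define M where "M = L \<inter> {y. l y \<le> b}"
      define N where "N = L \<inter> {y. b \<le> l y}"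
      have "k \<notin> M" using b unfolding M_def by simp
      then have xM: "x \<notin> cconv M"
        using min[of M] k L(1) closed_convex_halfspace(1)[OF l, of b] unfolding M_def
        by (metis Int_lower1 closed_Int)
      have LMN: "L = M \<union> N" unfolding M_def N_def by auto
      have N: "b \<le> l y" if "y \<in> cconv N" for y
        by (rule cconv_functional_ge[OF l _ that]) (auto simp: N_def)
      have "\<exists>z t. z \<in> cconv N \<and> 0 < t \<and> t \<le> 1 \<and> (\<exists>y\<in>cconv L. x = t *\<^sub>R z + (1 - t) *\<^sub>R y)"
      proof (cases "M = {}")
        case True
        then have "x \<in> cconv N" using L(3) LMN by simp
        then show ?thesis using L(3) by (intro exI[of _ x] exI[of _ 1]) auto
      next
        case False
        have "N \<noteq> {}" using k b unfolding N_def by auto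
        have "M \<subseteq> X" "N \<subseteq> X" using L(2) LMN by auto
        moreover have "x \<in> cconv (M \<union> N)" using L(3) LMN by simp
        ultimately have "\<exists>t\<in>{0..1}. \<exists>y\<in>cconv M. \<exists>z\<in>cconv N. x = t *\<^sub>R y + (1 - t) *\<^sub>R z"
          by (intro cconv_Un_decompose[OF X] False \<open>N \<noteq> {}\<close>)
        then obtain t y z where t: "t \<in> {0..1}" "y \<in> cconv M" "z \<in> cconv N"
          "x = t *\<^sub>R y + (1 - t) *\<^sub>R z" by blast
        have "t \<noteq> 1" using t xM by auto
        moreover have "y \<in> cconv L" using t(2) cconv_mono[of M L] LMN by blast
        ultimately show ?thesis
          using t by (intro exI[of _ z] exI[of _ "1 - t"]) (auto simp: add.commute)
      qed
      then obtain z t y where z: "z \<in> cconv N" "0 < t" "t \<le> 1" "y \<in> cconv L" "x = t *\<^sub>R z + (1 - t) *\<^sub>R y"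
        by blast
      have "z \<in> cconv L" using z(1) cconv_mono[of N L] LMN by blast
      then have "z \<in> generated_face (cconv L) x" unfolding generated_face_def using z by blast
      then show False using face N[OF z(1)] b by fastforce
    qed
  qed
qed

text \<open>Both the convex hull of \<open>L\<close> and the face generated by \<open>x\<close> are dense in the closed convex hull
  of \<open>L\<close>. The first density gives \<open>f p \<le> c\<close> at a point of continuity \<open>p\<close>, the second a part \<open>y\<close> of \<open>x\<close>
  near \<open>p\<close>, where \<open>f y \<le> c + e\<close>.\<close>

lemma affine_le_on_cconv:
  fixes K :: "'a::{locally_convex_space, t2_space} set"
  assumes X: "compact X" "convex X" and f: "affine_fun_on X f" "point_of_continuity_property X f"
    and K: "closed K" "K \<subseteq> X" and le: "\<And>k. k \<in> K \<Longrightarrow> f k \<le> c" and x: "x \<in> cconv K"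
  shows "f x \<le> c"
proof (rule field_le_epsilon)
  fix e :: real assume e: "e > 0"
  let ?H = "cconv K"
  have HX: "?H \<subseteq> X" "compact ?H" using compact_cconv[OF X K(2)] by auto
  have compact_K: "compact K" using compact_Int_closed[OF X(1) K(1)] K(2) by (simp add: Int_absorb1)
  obtain B where B: "\<And>x. x \<in> X \<Longrightarrow> \<bar>f x\<bar> \<le> B" using affine_pcp_imp_bounded[OF X f] by blast
  show "f x \<le> c + e"
  proof (rule affine_le_by_exhaustion[OF HX(2) convex_cconv affine_fun_on_subset[OF f(1) HX(1)] _ _ x])
    show "f x \<le> B" if "x \<in> ?H" for x using B[of x] HX that by fastforce
  next
    fix x assume x: "x \<in> ?H"
    obtain L where L: "closed L" "L \<subseteq> K" "x \<in> cconv L"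
      and min: "\<And>M. closed M \<Longrightarrow> M \<subseteq> L \<Longrightarrow> x \<in> cconv M \<Longrightarrow> M = L"
      using exists_minimal_generating_set[OF compact_K, of "{x}" "{}"] x by auto
    have LX: "L \<subseteq> X" using L K by blast
    have LH: "cconv L \<subseteq> ?H" using cconv_mono[OF L(2)] .
    obtain p where p: "p \<in> cconv L" "continuous (at p within cconv L) f"
      using pcp_obtain_point[OF f(2) closed_cconv, of L] LH HX L(3) by blast
    have hull: "convex hull L \<subseteq> {y \<in> X. f y \<le> c}"
    proof (rule hull_minimal)
      show "L \<subseteq> {y \<in> X. f y \<le> c}" using L LX le by blast
      show "convex {y \<in> X. f y \<le> c}"
      proof (rule convexI)
        fix y z and u v :: real
        assume *: "y \<in> {y \<in> X. f y \<le> c}" "z \<in> {y \<in> X. f y \<le> c}" "0 \<le> u" "0 \<le> v" "u + v = 1"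
        then have v: "v = 1 - u" by simp
        have "f (u *\<^sub>R y + v *\<^sub>R z) = u * f y + v * f z"
          unfolding v using * by (intro affine_fun_onD[OF f(1)]) auto
        also have "\<dots> \<le> c" using * by (intro convex_bound_le) auto
        finally show "u *\<^sub>R y + v *\<^sub>R z \<in> {y \<in> X. f y \<le> c}"
          using convexD[OF X(2), of y z u v] * by auto
      qed
    qed
    have "f p \<le> c"
    proof (rule ccontr)
      assume "\<not> f p \<le> c"
      then obtain W where W: "open W" "p \<in> W" "\<forall>y\<in>W \<inter> cconv L. \<bar>f y - f p\<bar> < f p - c"
        using continuous_within_nhd[OF p(2), of "f p - c"] by auto
      have "W \<inter> convex hull L \<noteq> {}"
        using W(1,2) p(1) open_Int_closure_eq_empty[of W "convex hull L"] unfolding cconv_def by blast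
      then obtain q where q: "q \<in> W" "q \<in> convex hull L" by blast
      have "q \<in> cconv L" using q(2) closure_subset unfolding cconv_def by blast
      then have "\<bar>f q - f p\<bar> < f p - c" using W(3) q(1) by blast
      moreover have "f q \<le> c" using q(2) hull by blast
      ultimately show False by linarith
    qed
    moreover obtain W where W: "open W" "p \<in> W" "\<forall>y\<in>W \<inter> cconv L. \<bar>f y - f p\<bar> < e"
      using continuous_within_nhd[OF p(2) e] by blast
    have "p \<in> closure (generated_face (cconv L) x)"
      using generated_face_dense[OF X L(1) LX L(3) min] p(1) by blast
    then have "W \<inter> generated_face (cconv L) x \<noteq> {}"
      using W(1,2) open_Int_closure_eq_empty[of W] by blast
    then obtain y where y: "y \<in> W" "y \<in> generated_face (cconv L) x" by blast
    then obtain t z where t: "y \<in> cconv L" "0 < t" "t \<le> 1" "z \<in> cconv L" "x = t *\<^sub>R y + (1 - t) *\<^sub>R z"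
      unfolding generated_face_def by blast
    have "\<bar>f y - f p\<bar> < e" using W(3) y(1) t(1) by blast
    ultimately have "f y \<le> c + e" by linarith
    then show "\<exists>t y z. 0 < t \<and> t \<le> 1 \<and> y \<in> ?H \<and> z \<in> ?H \<and> f y \<le> c + e \<and> x = t *\<^sub>R y + (1 - t) *\<^sub>R z"
      using t LH by blast
  qed
qed

section \<open>Slices of small oscillation\<close>

lemma affine_fun_on_minus: "affine_fun_on X f \<Longrightarrow> affine_fun_on X (\<lambda>x. - f x)"
  unfolding affine_fun_on_def by simp

lemma pcp_minus: "point_of_continuity_property X f \<Longrightarrow> point_of_continuity_property X (\<lambda>x. - f x)"
  unfolding point_of_continuity_property_def using continuous_minus by blast

lemma compact_separate_point:
  fixes L :: "'a::t2_space set"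
  assumes "compact L" "p \<in> W" "open W"
  shows "\<exists>M N. closed M \<and> closed N \<and> L = M \<union> N \<and> p \<notin> M \<and> N \<subseteq> W"
proof -
  have "compact (L - W)" using assms by (intro compact_diff)
  moreover have "Hausdorff_space (euclidean :: 'a topology)"
    unfolding Hausdorff_space_def disjnt_def open_openin[symmetric] using hausdorff by blast
  ultimately obtain U V where UV: "open U" "open V" "p \<in> U" "L - W \<subseteq> V" "disjnt U V"
    using Hausdorff_space_compact_separation[of euclidean "{p}" "L - W"] assms(2)
    by (auto simp: disjnt_def)
  have "closed (L - U)" "closed (L - V)"
    using UV compact_imp_closed[OF assms(1)] by auto
  moreover have "L = (L - U) \<union> (L - V)" using UV(5) by (auto simp: disjnt_def)
  ultimately show ?thesis using UV by (intro exI[of _ "L - U"] exI[of _ "L - V"]) auto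
qed

text \<open>With \<open>L = M \<union> N\<close>, where \<open>N\<close> is a small piece around a point of continuity \<open>p\<close> of \<open>F\<close> on \<open>L\<close>, each
  point of the hull is \<open>t y + (1 - t) z\<close> with \<open>y\<close> in the hull of \<open>B \<union> M\<close> and \<open>z\<close> in that of \<open>N\<close>. By minimality
  some \<open>l\<close> has a bound \<open>m1\<close> on the former hull that is smaller than the supremum \<open>m\<close>
  of \<open>l\<close> on the whole hull; values of \<open>l\<close>
  close to \<open>m\<close> then force \<open>t\<close> to be small, so that \<open>F\<close> is close to \<open>F z\<close>, hence to \<open>F p\<close>.\<close>

lemma exists_slice_of_small_oscillation:
  fixes X :: "'a::{locally_convex_space, t2_space} set"
  assumes X: "compact X" "convex X" and F: "affine_fun_on X F" "point_of_continuity_property X F"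
    and B: "B \<subseteq> X" "B \<noteq> {}" and K: "closed K" "K \<subseteq> X" and KB: "\<not> cconv (B \<union> K) \<subseteq> cconv B" and e: "0 < e"
  shows "\<exists>l a. continuous_functional l \<and> (\<forall>x\<in>B. l x < a) \<and> (\<exists>p\<in>cconv (B \<union> K). a < l p) \<and>
    (\<forall>p\<in>cconv (B \<union> K). \<forall>q\<in>cconv (B \<union> K). a < l p \<longrightarrow> a < l q \<longrightarrow> \<bar>F p - F q\<bar> < e)"
proof -
  let ?G = "cconv (B \<union> K)"
  have GX: "?G \<subseteq> X" "compact ?G" using compact_cconv[OF X, of "B \<union> K"] B K by auto
  have compact_K: "compact K" using compact_Int_closed[OF X(1) K(1)] K(2) by (simp add: Int_absorb1)
  obtain L where L: "closed L" "L \<subseteq> K" "?G \<subseteq> cconv (B \<union> L)"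
    and min: "\<And>M. closed M \<Longrightarrow> M \<subseteq> L \<Longrightarrow> ?G \<subseteq> cconv (B \<union> M) \<Longrightarrow> M = L"
    using exists_minimal_generating_set[OF compact_K, of ?G B] by auto
  have LX: "L \<subseteq> X" using L K by blast
  have compact_L: "compact L" using compact_Int_closed[OF X(1) L(1)] LX by (simp add: Int_absorb1)
  have "L \<noteq> {}" using L(3) KB by auto
  then obtain p where p: "p \<in> L" "continuous (at p within L) F"
    using pcp_obtain_point[OF F(2) L(1) LX] by blast
  obtain W where W: "open W" "p \<in> W" "\<forall>y\<in>W \<inter> L. \<bar>F y - F p\<bar> < e / 8"
    using continuous_within_nhd[OF p(2), of "e / 8"] e by auto
  obtain M N where MN: "closed M" "closed N" "L = M \<union> N" "p \<notin> M" "N \<subseteq> W"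
    using compact_separate_point[OF compact_L W(2,1)] by blast
  have "\<not> ?G \<subseteq> cconv (B \<union> M)" using min[OF MN(1)] MN p(1) by blast
  then obtain q where q: "q \<in> ?G" "q \<notin> cconv (B \<union> M)" by blast
  then obtain l m1 where l: "continuous_functional l" and m1: "\<forall>x\<in>cconv (B \<union> M). l x \<le> m1" "m1 < l q"
    using separate_from_cconv by blast
  have lin: "linear l" using l by simp
  have "compact (l ` ?G)"
    using l GX(2) by (intro compact_continuous_image) (auto intro: continuous_on_subset)
  then have bdd: "bdd_above (l ` ?G)" by (intro bounded_imp_bdd_above compact_imp_bounded)
  define m where "m = Sup (l ` ?G)"
  have m: "l x \<le> m" if "x \<in> ?G" for x unfolding m_def using that by (intro cSup_upper bdd) auto
  have m1m: "m1 < m" using m1(2) m[OF q(1)] by linarith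
  obtain C where C: "C > 0" "\<And>x. x \<in> X \<Longrightarrow> \<bar>F x\<bar> \<le> C" using affine_pcp_imp_bounded[OF X F] by blast
  \<comment> \<open>The weight \<open>t\<close> has to be at most \<open>h\<close>, as \<open>F\<close> varies by at most \<open>2 * C\<close>.\<close>
  define h where "h = min (1 / 2) (e / (16 * C))"
  have h: "0 < h" "h < 1" "h \<le> e / (16 * C)" using e C(1) unfolding h_def by auto
  then have hC: "h * (2 * C) \<le> e / 8" using C(1) by (simp add: field_simps)
  \<comment> \<open>The value of \<open>l\<close> at \<open>t y + (1 - t) z\<close> is at most \<open>t * m1 + (1 - t) * m\<close>, which exceeds \<open>a\<close> only if \<open>t < h\<close>.\<close>
  define a where "a = h * m1 + (1 - h) * m"
  have "a < h * m + (1 - h) * m" unfolding a_def using m1m h by simp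
  then have am: "a < m" by (simp add: algebra_simps)
  have "h * m1 + (1 - h) * m1 < a" unfolding a_def using m1m h by simp
  then have m1a: "m1 < a" by (simp add: algebra_simps)
  have NX: "N \<subseteq> X" "M \<subseteq> X" using MN(3) LX by auto
  have near_N: "\<bar>F z - F p\<bar> \<le> e / 8" if z: "z \<in> cconv N" for z
  proof -
    have N: "\<bar>F k - F p\<bar> < e / 8" if "k \<in> N" for k using W(3) MN that by blast
    have N1: "F k \<le> F p + e / 8" and N2: "- F k \<le> - F p + e / 8" if "k \<in> N" for k
      using N[OF that] by linarith+
    have "F z \<le> F p + e / 8"
      by (rule affine_le_on_cconv[OF X F MN(2) NX(1) N1 z])
    moreover have "- F z \<le> - F p + e / 8"
      by (rule affine_le_on_cconv[OF X affine_fun_on_minus[OF F(1)] pcp_minus[OF F(2)] MN(2) NX(1) N2 z])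
    ultimately show ?thesis by linarith
  qed
  have NG: "cconv N \<subseteq> ?G" using L(2) MN(3) by (intro cconv_mono) auto
  have near: "\<bar>F x - F p\<bar> \<le> e / 4" if x: "x \<in> ?G" "a < l x" for x
  proof -
    have "x \<in> cconv ((B \<union> M) \<union> N)" using x(1) L(3) unfolding MN(3) by (auto simp: Un_assoc)
    moreover have "B \<union> M \<subseteq> X" "B \<union> M \<noteq> {}" "N \<noteq> {}" using p(1) MN B NX by auto
    ultimately have "\<exists>t\<in>{0..1}. \<exists>y\<in>cconv (B \<union> M). \<exists>z\<in>cconv N. x = t *\<^sub>R y + (1 - t) *\<^sub>R z"
      by (intro cconv_Un_decompose[OF X] NX)
    then obtain t y z where t01: "t \<in> {0..1}" and t: "y \<in> cconv (B \<union> M)" "z \<in> cconv N"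
      "x = t *\<^sub>R y + (1 - t) *\<^sub>R z" by blast
    then have t: "0 \<le> t" "t \<le> 1" "y \<in> cconv (B \<union> M)" "z \<in> cconv N"
      "x = t *\<^sub>R y + (1 - t) *\<^sub>R z" by simp_all
    have "l x = t * l y + (1 - t) * l z"
      unfolding t(5) by (simp add: linear_add[OF lin] linear_scale[OF lin])
    also have "\<dots> \<le> t * m1 + (1 - t) * m"
      using t m1(1) m NG by (intro add_mono mult_left_mono) auto
    finally have "0 < (h - t) * (m - m1)" using x(2) unfolding a_def by (simp add: algebra_simps)
    then have "t < h" using m1m by (simp add: zero_less_mult_iff)
    have yX: "y \<in> X" using t(3) compact_cconv(1)[OF X, of "B \<union> M"] B NX by auto
    have zX: "z \<in> X" using t(4) NG GX by blast
    have "F x = t * F y + (1 - t) * F z" unfolding t(5) by (rule affine_fun_onD[OF F(1) yX zX t(1,2)])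
    then have "F x - F z = t * (F y - F z)" by (simp add: algebra_simps)
    then have "\<bar>F x - F z\<bar> = t * \<bar>F y - F z\<bar>" using t(1) by (simp add: abs_mult)
    also have "\<dots> \<le> h * (2 * C)"
      using \<open>t < h\<close> t(1) C(2)[OF yX] C(2)[OF zX] by (intro mult_mono) auto
    finally have "\<bar>F x - F z\<bar> \<le> e / 8" using hC by linarith
    then show ?thesis using near_N[OF t(4)] by linarith
  qed
  have "\<exists>p\<in>?G. a < l p"
    using am less_cSup_iff[of "l ` ?G" a] bdd q(1) unfolding m_def by auto
  moreover have "\<forall>x\<in>B. l x < a" using m1(1) m1a subset_cconv[of "B \<union> M"] by fastforce
  moreover have "\<forall>x\<in>?G. \<forall>y\<in>?G. a < l x \<longrightarrow> a < l y \<longrightarrow> \<bar>F x - F y\<bar> < e"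
  proof (intro ballI impI)
    fix x y assume "x \<in> ?G" "y \<in> ?G" "a < l x" "a < l y"
    then have "\<bar>F x - F p\<bar> \<le> e / 4" "\<bar>F y - F p\<bar> \<le> e / 4" using near by blast+
    then show "\<bar>F x - F y\<bar> < e" using e by linarith
  qed
  ultimately show ?thesis using l by blast
qed

section \<open>Perturbation of superlevel sets\<close>

lemma pcp_add_continuous:
  assumes "point_of_continuity_property X f" "continuous_on UNIV h"
  shows "point_of_continuity_property X (\<lambda>x. f x + h x)"
  unfolding point_of_continuity_property_def
proof (intro allI impI)
  fix F assume "closedin (top_of_set X) F \<and> F \<noteq> {}"
  then obtain x where x: "x \<in> F" "continuous (at x within F) f"
    using assms(1) unfolding point_of_continuity_property_def by blast
  have "continuous (at x within F) h"
    using assms(2) by (simp add: continuous_on_eq_continuous_at continuous_at_imp_continuous_at_within)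
  then show "\<exists>x\<in>F. continuous (at x within F) (\<lambda>x. f x + h x)"
    using x by (intro bexI[of _ x] continuous_add)
qed

lemma affine_fun_on_add:
  assumes "affine_fun_on X f" "affine_fun_on X h"
  shows "affine_fun_on X (\<lambda>x. f x + h x)"
  unfolding affine_fun_on_def
proof (intro ballI)
  fix x y and t :: real
  assume "x \<in> X" "y \<in> X" "t \<in> {0..1}"
  then have "f (t *\<^sub>R x + (1 - t) *\<^sub>R y) = t * f x + (1 - t) * f y"
    "h (t *\<^sub>R x + (1 - t) *\<^sub>R y) = t * h x + (1 - t) * h y"
    using assms unfolding affine_fun_on_def by blast+
  then show "f (t *\<^sub>R x + (1 - t) *\<^sub>R y) + h (t *\<^sub>R x + (1 - t) *\<^sub>R y)
      = t * (f x + h x) + (1 - t) * (f y + h y)"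
    by (simp add: distrib_left)
qed

text \<open>The projection of a closed set \<open>F\<close> to \<open>X\<close> is closed, and \<open>f \<circ> fst\<close> is continuous on \<open>F\<close> at every
  point above a point of continuity of \<open>f\<close> on the projection.\<close>

lemma pcp_height_above_graph:
  fixes X :: "'a::t2_space set"
  assumes f: "point_of_continuity_property X f" and Y: "Y \<subseteq> X \<times> UNIV" "compact Y"
  shows "point_of_continuity_property Y (\<lambda>p. snd p - f (fst p))"
  unfolding point_of_continuity_property_def
proof (intro allI impI)
  fix F assume F: "closedin (top_of_set Y) F \<and> F \<noteq> {}"
  then have "compact F" using closedin_compact[OF Y(2)] by blast
  then have "compact (fst ` F)" by (intro compact_continuous_image continuous_intros)
  then have "closed (fst ` F)" by (rule compact_imp_closed)
  moreover have "F \<subseteq> Y" using F closedin_imp_subset by blast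
  then have "fst ` F \<subseteq> X" using Y(1) by auto
  ultimately obtain x where x: "x \<in> fst ` F" "continuous (at x within fst ` F) f"
    using pcp_obtain_point[OF f] F by blast
  then obtain p where p: "p \<in> F" "x = fst p" by blast
  have "continuous (at p within F) (\<lambda>q. f (fst q))"
  proof (rule continuous_within_compose2[where g = f and f = fst])
    show "continuous (at p within F) fst" by (intro continuous_intros)
    show "continuous (at (fst p) within fst ` F) f" using x(2) p(2) by simp
  qed
  then have "continuous (at p within F) (\<lambda>q. snd q - f (fst q))" by (intro continuous_intros)
  then show "\<exists>p\<in>F. continuous (at p within F) (\<lambda>q. snd q - f (fst q))" using p(1) by blast
qed

text \<open>The slice of the closed convex hull of floor and graph is given by \<open>l (x, t) = l (x, 0) + t * \<alpha>\<close>.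
  It contains a point of the graph but none of the floor, so \<open>\<alpha> > 0\<close>, and for \<open>h x = l (x, 0) / \<alpha>\<close> the
  superlevel sets of \<open>f + h\<close> consist of those \<open>x\<close> for which \<open>l (x, f x)\<close> exceeds a given level. If this
  level is at least \<open>a\<close>, then \<open>f x > d\<close> because \<open>l (x, d) < a\<close>, so \<open>(x, f x)\<close> is in the hull.\<close>

lemma superlevel_perturbation:
  fixes X :: "'a::{locally_convex_space, t2_space} set"
  assumes X: "compact X" "convex X" and f: "affine_fun_on X f" "point_of_continuity_property X f"
    and x0: "x0 \<in> X" "c < f x0"
  shows "\<exists>h c'. affine_fun_on X h \<and> continuous_on UNIV h \<and> (\<exists>x\<in>X. c' < f x + h x) \<and>
    closure {x \<in> X. c' < f x + h x} \<subseteq> {x \<in> X. c < f x}"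
proof -
  obtain d where d: "c < d" "d < f x0" using dense[OF x0(2)] by blast
  obtain C where C: "\<And>x. x \<in> X \<Longrightarrow> \<bar>f x\<bar> \<le> C" using affine_pcp_imp_bounded[OF X f] by blast
  have dC: "d \<le> C" using C[OF x0(1)] d by linarith
  define Y where "Y = X \<times> {d..C}"
  define G where "G = {(x, f x) |x. x \<in> X \<and> d < f x}"
  define K where "K = closure G"
  define B where "B = X \<times> {d}"
  define F where "F p = snd p - f (fst p)" for p :: "'a \<times> real"
  have Y: "compact Y" "convex Y" unfolding Y_def using X by (auto intro: compact_Times convex_Times)
  have "affine_fun_on Y F"
    unfolding affine_fun_on_def
  proof (intro ballI)
    fix p q and t :: real
    assume pq: "p \<in> Y" "q \<in> Y" and t: "t \<in> {0..1}"
    have "fst p \<in> X" "fst q \<in> X" using pq unfolding Y_def by auto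
    then have "f (t *\<^sub>R fst p + (1 - t) *\<^sub>R fst q) = t * f (fst p) + (1 - t) * f (fst q)"
      using affine_fun_onD[OF f(1)] t by simp
    then show "F (t *\<^sub>R p + (1 - t) *\<^sub>R q) = t * F p + (1 - t) * F q"
      unfolding F_def fst_add snd_add fst_scaleR snd_scaleR by (simp add: right_diff_distrib)
  qed
  moreover have "point_of_continuity_property Y F"
    unfolding F_def by (rule pcp_height_above_graph[OF f(2) _ Y(1)]) (auto simp: Y_def)
  ultimately have F: "affine_fun_on Y F" "point_of_continuity_property Y F" .
  have BY: "B \<subseteq> Y" "B \<noteq> {}" unfolding B_def Y_def using dC x0 by auto
  have "G \<subseteq> Y"
  proof
    fix p assume "p \<in> G"
    then obtain x where x: "x \<in> X" "d < f x" "p = (x, f x)" unfolding G_def by blast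
    have "f x \<le> C" using C[OF x(1)] by linarith
    then show "p \<in> Y" unfolding Y_def x(3) using x(1,2) by simp
  qed
  then have KY: "closed K" "K \<subseteq> Y" unfolding K_def
    using closure_minimal[OF _ compact_imp_closed[OF Y(1)]] by simp_all
  have GK: "G \<subseteq> K" unfolding K_def by (rule closure_subset)
  let ?G = "cconv (B \<union> K)"
  have snd: "continuous_functional (snd :: 'a \<times> real \<Rightarrow> real)"
    by (auto intro!: continuous_intros linearI)
  have GY: "?G \<subseteq> Y" "compact ?G" using compact_cconv[OF Y, of "B \<union> K"] BY KY by auto
  have x0K: "(x0, f x0) \<in> K" using GK d x0 unfolding G_def by blast
  have not_sub: "\<not> ?G \<subseteq> cconv B"
  proof
    assume "?G \<subseteq> cconv B"
    then have "(x0, f x0) \<in> cconv B" using x0K subset_cconv[of "B \<union> K"] by blast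
    moreover have "snd p \<le> d" if "p \<in> B" for p using that unfolding B_def by auto
    ultimately have "snd (x0, f x0) \<le> d" using cconv_functional_le[OF snd] by blast
    then show False using d by simp
  qed
  have "0 < d - c" using d by simp
  from exists_slice_of_small_oscillation[OF Y F BY KY not_sub this] obtain l a where l: "continuous_functional l" and lB: "\<forall>x\<in>B. l x < a"
    and ne: "\<exists>p\<in>?G. a < l p"
    and osc: "\<forall>p\<in>?G. \<forall>q\<in>?G. a < l p \<longrightarrow> a < l q \<longrightarrow> \<bar>F p - F q\<bar> < d - c"
    by blast
  have lin: "linear l" using l by simp
  define \<alpha> where "\<alpha> = l (0, 1)"
  have l_eq: "l (x, t) = l (x, 0) + t * \<alpha>" for x t
  proof -
    have "(x, t) = (x, 0) + t *\<^sub>R (0, 1)" by simp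
    then have "l (x, t) = l ((x, 0) + t *\<^sub>R (0, 1))" by (rule arg_cong)
    also have "\<dots> = l (x, 0) + t * \<alpha>"
      unfolding \<alpha>_def linear_add[OF lin] linear_scale[OF lin] by simp
    finally show ?thesis .
  qed
  have "\<exists>g\<in>G. a < l g"
  proof (rule ccontr)
    assume "\<not> (\<exists>g\<in>G. a < l g)"
    then have "G \<subseteq> {p. l p \<le> a}" by (auto simp: not_less)
    then have "K \<subseteq> {p. l p \<le> a}"
      unfolding K_def by (rule closure_minimal[OF _ closed_convex_halfspace(1)[OF l]])
    then have le: "l p \<le> a" if "p \<in> B \<union> K" for p using that lB by (auto intro: less_imp_le)
    obtain p where p: "p \<in> ?G" "a < l p" using ne by blast
    have "l p \<le> a" by (rule cconv_functional_le[OF l le p(1)])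
    then show False using p(2) by simp
  qed
  then obtain x1 where x1: "x1 \<in> X" "d < f x1" "a < l (x1, f x1)" unfolding G_def by blast
  have "l (x1, d) < a" using lB x1 unfolding B_def by auto
  then have "0 < (f x1 - d) * \<alpha>" using x1(3) l_eq[of x1 d] l_eq[of x1 "f x1"] by (simp add: algebra_simps)
  then have \<alpha>: "0 < \<alpha>" using x1(2) by (simp add: zero_less_mult_iff)
  \<comment> \<open>A level above \<open>a\<close>, so that limits of points above the level stay in the open slice.\<close>
  obtain b where b: "a < b" "b < l (x1, f x1)" using dense[OF x1(3)] by blast
  define h where "h x = l (x, 0) / \<alpha>" for x
  have level: "b / \<alpha> < f x + h x \<longleftrightarrow> b < l (x, f x)" for x
  proof -
    have "b / \<alpha> < f x + h x \<longleftrightarrow> b < (f x + h x) * \<alpha>" by (rule pos_divide_less_eq[OF \<alpha>])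
    also have "(f x + h x) * \<alpha> = l (x, f x)"
      unfolding h_def l_eq[of x "f x"] using \<alpha> by (simp add: distrib_right)
    finally show ?thesis .
  qed
  have "affine_fun_on X h"
    unfolding affine_fun_on_def
  proof (intro ballI)
    fix x y :: 'a and t :: real
    have "(t *\<^sub>R x + (1 - t) *\<^sub>R y, 0::real) = t *\<^sub>R (x, 0) + (1 - t) *\<^sub>R (y, 0)" by simp
    then have "l (t *\<^sub>R x + (1 - t) *\<^sub>R y, 0) = l (t *\<^sub>R (x, 0) + (1 - t) *\<^sub>R (y, 0))"
      by (rule arg_cong)
    also have "\<dots> = t * l (x, 0) + (1 - t) * l (y, 0)"
      unfolding linear_add[OF lin] linear_scale[OF lin] by simp
    finally have "l (t *\<^sub>R x + (1 - t) *\<^sub>R y, 0) = t * l (x, 0) + (1 - t) * l (y, 0)" .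
    then show "h (t *\<^sub>R x + (1 - t) *\<^sub>R y) = t * h x + (1 - t) * h y"
      unfolding h_def by (simp only: add_divide_distrib times_divide_eq_right)
  qed
  moreover have "continuous_on UNIV h"
  proof -
    have lc: "continuous_on UNIV l" using l by simp
    have "continuous_on UNIV (\<lambda>x :: 'a. (x, 0 :: real))" by (intro continuous_intros)
    from continuous_on_compose2[OF lc this] have "continuous_on UNIV (\<lambda>x. l (x, 0))" by simp
    then show ?thesis unfolding h_def using \<alpha> by (intro continuous_on_divide continuous_on_const) simp_all
  qed
  moreover have "\<exists>x\<in>X. b / \<alpha> < f x + h x" using x1(1) b(2) level by blast
  moreover have "closure {x \<in> X. b / \<alpha> < f x + h x} \<subseteq> {x \<in> X. c < f x}"
  proof -
    define Q where "Q = ?G \<inter> {p. b \<le> l p}"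
    have "compact Q"
      unfolding Q_def by (rule compact_Int_closed[OF GY(2) closed_convex_halfspace(3)[OF l]])
    then have "compact (fst ` Q)" by (intro compact_continuous_image continuous_intros)
    then have cl: "closed (fst ` Q)" by (rule compact_imp_closed)
    have inG: "(x, f x) \<in> ?G" if "x \<in> X" "a < l (x, f x)" for x
    proof -
      have "l (x, d) < a" using lB that unfolding B_def by auto
      then have "0 < (f x - d) * \<alpha>" using that l_eq[of x d] l_eq[of x "f x"] by (simp add: algebra_simps)
      then have "d < f x" using \<alpha> by (simp add: zero_less_mult_iff)
      then have "(x, f x) \<in> G" unfolding G_def using that by blast
      then show ?thesis using GK subset_cconv[of "B \<union> K"] by blast
    qed
    have "{x \<in> X. b / \<alpha> < f x + h x} \<subseteq> fst ` Q"
    proof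
      fix x assume "x \<in> {x \<in> X. b / \<alpha> < f x + h x}"
      then have x: "x \<in> X" "b < l (x, f x)" using level by simp_all
      then have "(x, f x) \<in> ?G" using b(1) by (intro inG) linarith+
      then have "(x, f x) \<in> Q" unfolding Q_def using x(2) by simp
      then show "x \<in> fst ` Q" by (rule image_eqI[rotated]) simp
    qed
    then have "closure {x \<in> X. b / \<alpha> < f x + h x} \<subseteq> fst ` Q" using cl by (rule closure_minimal)
    moreover have "fst ` Q \<subseteq> {x \<in> X. c < f x}"
    proof
      fix y assume "y \<in> fst ` Q"
      then obtain t where yt: "(y, t) \<in> Q" by auto
      have "(y, t) \<in> Y" using yt GY(1) unfolding Q_def by blast
      then have y: "y \<in> X" "d \<le> t" unfolding Y_def by auto
      have "\<bar>F (y, t) - F (x1, f x1)\<bar> < d - c"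
      proof -
        have "(y, t) \<in> ?G" "b \<le> l (y, t)" using yt unfolding Q_def by auto
        then have "a < l (y, t)" using b by simp
        then show ?thesis using osc \<open>(y, t) \<in> ?G\<close> inG[OF x1(1,3)] x1(3) by blast
      qed
      then have "t - f y < d - c" unfolding F_def by simp
      then show "y \<in> {x \<in> X. c < f x}" using y by simp
    qed
    ultimately show ?thesis by blast
  qed
  ultimately show ?thesis by (intro exI[of _ h] exI[of _ "b / \<alpha>"] conjI)
qed

section \<open>Compact extremal sets\<close>

text \<open>Midpoints are enough to detect extreme points. For an arbitrary point inside a segment, how close
  to its supremum a function must be there for its values at the endpoints to be large depends on the
  ratio in which the point divides the segment.\<close>

definition midpoint_extremal :: "'a::real_vector set \<Rightarrow> 'a set \<Rightarrow> bool" where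
  "midpoint_extremal X G \<longleftrightarrow>
    G \<subseteq> X \<and> (\<forall>a\<in>X. \<forall>b\<in>X. (1 / 2) *\<^sub>R a + (1 / 2) *\<^sub>R b \<in> G \<longrightarrow> a \<in> G \<and> b \<in> G)"

text \<open>The level \<open>c'\<close> is halfway between the level \<open>k\<close> of the perturbation lemma and the supremum
  \<open>m\<close> of \<open>g\<close>: if \<open>g\<close> exceeds \<open>(m + k) / 2\<close> at a midpoint, it exceeds \<open>k\<close> at both endpoints.\<close>

lemma superlevel_step:
  fixes X :: "'a::{locally_convex_space, t2_space} set"
  assumes X: "compact X" "convex X" and f: "affine_fun_on X f" "point_of_continuity_property X f"
    and ne: "\<exists>x\<in>X. c < f x"
  shows "\<exists>g c'. affine_fun_on X g \<and> point_of_continuity_property X g \<and> (\<exists>x\<in>X. c' < g x) \<and>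
    closure {x \<in> X. c' < g x} \<subseteq> {x \<in> X. c < f x} \<and>
    (\<forall>a\<in>X. \<forall>b\<in>X. c' < g ((1 / 2) *\<^sub>R a + (1 / 2) *\<^sub>R b) \<longrightarrow> c < f a \<and> c < f b)"
proof -
  obtain h k where h: "affine_fun_on X h" "continuous_on UNIV h" "\<exists>x\<in>X. k < f x + h x"
    "closure {x \<in> X. k < f x + h x} \<subseteq> {x \<in> X. c < f x}"
    using superlevel_perturbation[OF X f] ne by blast
  define g where "g x = f x + h x" for x
  have g: "affine_fun_on X g" "point_of_continuity_property X g"
    unfolding g_def using affine_fun_on_add[OF f(1) h(1)] pcp_add_continuous[OF f(2) h(2)] .
  obtain C where C: "\<And>x. x \<in> X \<Longrightarrow> \<bar>g x\<bar> \<le> C" using affine_pcp_imp_bounded[OF X g] by blast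
  have bdd: "bdd_above (g ` X)" using C by (intro bdd_aboveI2[of _ _ C]) (simp add: abs_le_iff)
  define m where "m = Sup (g ` X)"
  have m: "g x \<le> m" if "x \<in> X" for x unfolding m_def using that by (intro cSup_upper bdd) auto
  obtain x1 where x1: "x1 \<in> X" "k < g x1" using h(3) unfolding g_def by blast
  have km: "k < m" using x1 m[of x1] by linarith
  define c' where "c' = (m + k) / 2"
  have "2 * c' = m + k" unfolding c'_def by (metis field_sum_of_halves mult_2)
  then have c': "k < c'" "c' < m" "2 * c' - m = k" using km by simp_all
  have sub: "closure {x \<in> X. k < g x} \<subseteq> {x \<in> X. c < f x}" using h(4) unfolding g_def .
  have "\<exists>x\<in>X. c' < g x"
  proof -
    have "g ` X \<noteq> {}" using x1(1) by blast
    then have "\<exists>y\<in>g ` X. c' < y" using c'(2) less_cSup_iff[OF _ bdd] unfolding m_def by blast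
    then show ?thesis by blast
  qed
  moreover have "closure {x \<in> X. c' < g x} \<subseteq> {x \<in> X. c < f x}"
  proof -
    have "{x \<in> X. c' < g x} \<subseteq> {x \<in> X. k < g x}" using c'(1) by auto
    then show ?thesis using sub closure_mono by (meson subset_trans)
  qed
  moreover have "c < f a \<and> c < f b"
    if ab: "a \<in> X" "b \<in> X" "c' < g ((1 / 2) *\<^sub>R a + (1 / 2) *\<^sub>R b)" for a b
  proof -
    have "g ((1 / 2) *\<^sub>R a + (1 / 2) *\<^sub>R b) = g a / 2 + g b / 2"
      using affine_fun_onD[OF g(1) ab(1,2), of "1 / 2"] by simp
    then have "k < g a" "k < g b" using ab(3) m[OF ab(1)] m[OF ab(2)] c'(3) by linarith+
    then have "a \<in> {x \<in> X. k < g x}" "b \<in> {x \<in> X. k < g x}" using ab by auto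
    moreover have "{x \<in> X. k < g x} \<subseteq> {x \<in> X. c < f x}" using sub closure_subset by (rule subset_trans[rotated])
    ultimately show ?thesis by blast
  qed
  ultimately have "affine_fun_on X g \<and> point_of_continuity_property X g \<and> (\<exists>x\<in>X. c' < g x) \<and>
      closure {x \<in> X. c' < g x} \<subseteq> {x \<in> X. c < f x} \<and>
      (\<forall>a\<in>X. \<forall>b\<in>X. c' < g ((1 / 2) *\<^sub>R a + (1 / 2) *\<^sub>R b) \<longrightarrow> c < f a \<and> c < f b)"
    using g by simp
  then show ?thesis by (intro exI)
qed

lemma exists_compact_extremal_superlevel_subset:
  fixes X :: "'a::{locally_convex_space, t2_space} set"
  assumes X: "compact X" "convex X" and f: "affine_fun_on X f" "point_of_continuity_property X f"
    and ne: "\<exists>x\<in>X. c < f x"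
  shows "\<exists>G. compact G \<and> G \<noteq> {} \<and> midpoint_extremal X G \<and> (\<forall>x\<in>G. c < f x)"
proof -
  define P where "P s \<longleftrightarrow> affine_fun_on X (fst s) \<and> point_of_continuity_property X (fst s) \<and>
    (\<exists>x\<in>X. snd s < fst s x)" for s :: "('a \<Rightarrow> real) \<times> real"
  define A where "A s = {x \<in> X. snd s < fst s x}" for s :: "('a \<Rightarrow> real) \<times> real"
  define R where "R s s' \<longleftrightarrow> closure (A s') \<subseteq> A s \<and>
    (\<forall>a\<in>X. \<forall>b\<in>X. (1 / 2) *\<^sub>R a + (1 / 2) *\<^sub>R b \<in> A s' \<longrightarrow> a \<in> A s \<and> b \<in> A s)" for s s'
  have step: "\<exists>s'. P s' \<and> R s s'" if "P s" for s
  proof -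
    obtain g c' where g: "affine_fun_on X g" "point_of_continuity_property X g" "\<exists>x\<in>X. c' < g x"
      "closure {x \<in> X. c' < g x} \<subseteq> {x \<in> X. snd s < fst s x}"
      "\<forall>a\<in>X. \<forall>b\<in>X. c' < g ((1 / 2) *\<^sub>R a + (1 / 2) *\<^sub>R b) \<longrightarrow> snd s < fst s a \<and> snd s < fst s b"
      using superlevel_step[OF X, of "fst s" "snd s"] \<open>P s\<close> unfolding P_def by blast
    then show ?thesis
      by (intro exI[of _ "(g, c')"]) (auto simp: P_def R_def A_def)
  qed
  define nx where "nx s = (SOME s'. P s' \<and> R s s')" for s
  have nx: "P (nx s) \<and> R s (nx s)" if "P s" for s
    unfolding nx_def by (rule someI_ex[OF step[OF that]])
  define s where "s n = (nx ^^ n) (f, c)" for n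
  have s0: "s 0 = (f, c)" and sS: "s (Suc n) = nx (s n)" for n unfolding s_def by auto
  have Ps: "P (s n)" for n
    by (induction n) (use f ne nx in \<open>auto simp: s0 sS P_def[of "(f, c)"]\<close>)
  have Rs: "R (s n) (s (Suc n))" for n using nx[OF Ps] unfolding sS by blast
  let ?A = "\<lambda>n. A (s n)"
  have cl: "closure (?A (Suc n)) \<subseteq> ?A n" for n using Rs[of n] unfolding R_def by blast
  have dec: "closure (?A n) \<subseteq> closure (?A m)" if "m \<le> n" for m n
    using that
  proof (induction n rule: dec_induct)
    case (step n)
    have "closure (?A (Suc n)) \<subseteq> closure (?A n)" using cl[of n] closure_subset[of "?A n"] by blast
    then show ?case using step by blast
  qed simp
  define G where "G = (\<Inter>n. closure (?A n))"
  have GA: "G \<subseteq> ?A n" for n using cl[of n] unfolding G_def by blast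
  have AX: "?A n \<subseteq> X" for n unfolding A_def by blast
  have clX: "closure (?A n) \<subseteq> X" for n by (rule closure_minimal[OF AX compact_imp_closed[OF X(1)]])
  have "G \<noteq> {}"
    unfolding G_def
  proof (rule compact_chain_Inter_nonempty[OF X(1)])
    fix L assume "L \<in> range (\<lambda>n. closure (?A n))"
    then obtain n where L: "L = closure (?A n)" by blast
    have "?A n \<noteq> {}" using Ps[of n] unfolding P_def A_def by blast
    then show "closed L \<and> L \<subseteq> X \<and> L \<noteq> {}" using clX[of n] unfolding L by simp
  next
    fix L M assume "L \<in> range (\<lambda>n. closure (?A n))" "M \<in> range (\<lambda>n. closure (?A n))"
    then obtain m n where "L = closure (?A m)" "M = closure (?A n)" by blast
    then show "L \<subseteq> M \<or> M \<subseteq> L" using dec[of m n] dec[of n m] by (meson nat_le_linear)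
  qed simp
  moreover have "compact G"
  proof -
    have "closed G" unfolding G_def by (intro closed_INT) auto
    moreover have "G = X \<inter> G" using clX unfolding G_def by blast
    ultimately show ?thesis using compact_Int_closed[OF X(1)] by metis
  qed
  moreover have "midpoint_extremal X G"
    unfolding midpoint_extremal_def
  proof (intro conjI ballI impI)
    show "G \<subseteq> X" using GA AX by blast
    fix a b assume ab: "a \<in> X" "b \<in> X" "(1 / 2) *\<^sub>R a + (1 / 2) *\<^sub>R b \<in> G"
    have "a \<in> ?A n \<and> b \<in> ?A n" for n using Rs[of n] ab GA[of "Suc n"] unfolding R_def by blast
    then show "a \<in> G" "b \<in> G" unfolding G_def using closure_subset by blast+
  qed
  moreover have "\<forall>x\<in>G. c < f x" using GA[of 0] unfolding s0 A_def by auto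
  ultimately show ?thesis by blast
qed

text \<open>A point inside a segment is the midpoint of a shorter segment.\<close>

lemma extremal_singleton_imp_extreme_point:
  assumes X: "convex X" and e: "midpoint_extremal X {e}"
  shows "e extreme_point_of X"
  unfolding extreme_point_of_def
proof (intro conjI ballI notI)
  show "e \<in> X" using e unfolding midpoint_extremal_def by blast
  fix a b assume ab: "a \<in> X" "b \<in> X" "e \<in> open_segment a b"
  then obtain u where u: "a \<noteq> b" "0 < u" "u < 1" "e = (1 - u) *\<^sub>R a + u *\<^sub>R b"
    unfolding in_segment by blast
  define s where "s = min u (1 - u)"
  have s: "0 < s" "0 \<le> u - s" "u + s \<le> 1" using u unfolding s_def by auto
  have "(1 - v) *\<^sub>R a + v *\<^sub>R b \<in> X" if "0 \<le> v" "v \<le> 1" for v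
    using convexD[OF X ab(1,2)] that by simp
  then have "(1 - (u + s)) *\<^sub>R a + (u + s) *\<^sub>R b \<in> X" "(1 - (u - s)) *\<^sub>R a + (u - s) *\<^sub>R b \<in> X"
    using s u by auto
  moreover have "(1 / 2) *\<^sub>R ((1 - (u + s)) *\<^sub>R a + (u + s) *\<^sub>R b) +
      (1 / 2) *\<^sub>R ((1 - (u - s)) *\<^sub>R a + (u - s) *\<^sub>R b) = e"
    (is "?m = e")
  proof -
    have "(1 / 2) *\<^sub>R ((1 - v) *\<^sub>R a + v *\<^sub>R b) + (1 / 2) *\<^sub>R ((1 - w) *\<^sub>R a + w *\<^sub>R b) =
        (1 - (v + w) / 2) *\<^sub>R a + ((v + w) / 2) *\<^sub>R b" for v w :: real
      by (simp add: algebra_simps add_divide_distrib flip: scaleR_add_left)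
    from this[of "u + s" "u - s"] show ?thesis using u(4) by simp
  qed
  ultimately have "(1 - (u + s)) *\<^sub>R a + (u + s) *\<^sub>R b = e"
    using e unfolding midpoint_extremal_def by blast
  then have "s *\<^sub>R (b - a) = 0" unfolding u(4) by (simp add: algebra_simps)
  then show False using s u by simp
qed

text \<open>The Krein--Milman argument: a minimal closed extremal subset is a singleton, because the points
  where a functional attains its maximum on an extremal set form an extremal set.\<close>

lemma compact_extremal_contains_extreme_point:
  fixes X :: "'a::{locally_convex_space, t2_space} set"
  assumes X: "convex X" and G: "compact G" "G \<noteq> {}" "midpoint_extremal X G"
  shows "\<exists>e\<in>G. e extreme_point_of X"
proof -
  let ?P = "\<lambda>L. L \<noteq> {} \<and> midpoint_extremal X L"
  have "\<exists>L. closed L \<and> L \<subseteq> G \<and> ?P L \<and> (\<forall>M. closed M \<and> M \<subseteq> L \<and> ?P M \<longrightarrow> M = L)"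
  proof (rule compact_Zorn_minimal[where P = ?P])
    fix \<C> assume ne: "\<C> \<noteq> {}" and \<C>: "\<And>L. L \<in> \<C> \<Longrightarrow> closed L \<and> L \<subseteq> G \<and> ?P L"
      and total: "\<And>L M. L \<in> \<C> \<Longrightarrow> M \<in> \<C> \<Longrightarrow> L \<subseteq> M \<or> M \<subseteq> L"
    have "\<Inter>\<C> \<noteq> {}"
      by (rule compact_chain_Inter_nonempty[OF G(1) ne _ total]) (use \<C> in simp_all)
    moreover have "midpoint_extremal X (\<Inter>\<C>)"
      using ne \<C> unfolding midpoint_extremal_def by blast
    ultimately show "?P (\<Inter>\<C>)" by blast
  qed (use G in simp_all)
  then obtain L where L: "closed L" "L \<subseteq> G" "L \<noteq> {}" "midpoint_extremal X L"
    and min: "\<And>M. closed M \<Longrightarrow> M \<subseteq> L \<Longrightarrow> M \<noteq> {} \<Longrightarrow> midpoint_extremal X M \<Longrightarrow> M = L"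
    by auto
  have "x = y" if xy: "x \<in> L" "y \<in> L" for x y
  proof (rule ccontr)
    assume "x \<noteq> y"
    then obtain l a where l: "continuous_functional l" and la: "l y \<le> a" "a < l x"
      using separate_point_closed_convex[of "{y}" x] by auto
    have lin: "linear l" using l by simp
    have "compact L" using compact_Int_closed[OF G(1) L(1)] L(2) by (simp add: Int_absorb1)
    then obtain w where w: "w \<in> L" "\<forall>z\<in>L. l z \<le> l w"
      using continuous_attains_sup[of L l] L(3) l continuous_on_subset by blast
    have "L \<inter> {z. l w \<le> l z} = L"
    proof (rule min)
      show "closed (L \<inter> {z. l w \<le> l z})" by (intro closed_Int L(1) closed_convex_halfspace(3)[OF l])
      show "L \<inter> {z. l w \<le> l z} \<noteq> {}" using w(1) by auto
      show "midpoint_extremal X (L \<inter> {z. l w \<le> l z})"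
        unfolding midpoint_extremal_def
      proof (intro conjI ballI impI)
        show "L \<inter> {z. l w \<le> l z} \<subseteq> X" using L(4) unfolding midpoint_extremal_def by blast
        fix a b assume ab: "a \<in> X" "b \<in> X" "(1 / 2) *\<^sub>R a + (1 / 2) *\<^sub>R b \<in> L \<inter> {z. l w \<le> l z}"
        then have abL: "a \<in> L" "b \<in> L" using L(4) unfolding midpoint_extremal_def by blast+
        have "l w \<le> l a / 2 + l b / 2" using ab(3) by (simp add: linear_add[OF lin] linear_scale[OF lin])
        moreover have "l a \<le> l w" "l b \<le> l w" using w(2) abL by auto
        ultimately show "a \<in> L \<inter> {z. l w \<le> l z}" "b \<in> L \<inter> {z. l w \<le> l z}" using abL by auto
      qed
    qed simp
    then have "l w \<le> l y" using xy(2) by blast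
    then show False using w(2) xy la by fastforce
  qed
  then obtain e where "L = {e}" using L(3) by blast
  then show ?thesis
    using extremal_singleton_imp_extreme_point[OF X] L(2,4) by blast
qed

section \<open>The minimum principle\<close>

theorem theorem1p1:
  fixes X :: "'a::{locally_convex_space, t2_space} set" and f :: "'a \<Rightarrow> real"
  assumes "compact X" and "convex X"
    and "affine_fun_on X f"
    and "point_of_continuity_property X f"
    and "\<forall>x. x extreme_point_of X \<longrightarrow> f x \<le> 0"
  shows "\<forall>x\<in>X. f x \<le> 0"
proof (rule ccontr)
  assume "\<not> (\<forall>x\<in>X. f x \<le> 0)"
  then have "\<exists>x\<in>X. 0 < f x" by force
  then obtain G where G: "compact G" "G \<noteq> {}" "midpoint_extremal X G" "\<forall>x\<in>G. 0 < f x"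
    using exists_compact_extremal_superlevel_subset[OF assms(1-4)] by blast
  obtain e where "e \<in> G" "e extreme_point_of X"
    using compact_extremal_contains_extreme_point[OF assms(2) G(1-3)] by blast
  then show False using G(4) assms(5) by force
qed

end
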